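(* Let $\Psi(t,u):=\sum_{n=0}^{\infty}Q_{F_n}(t)\,u^n$ be the generating function of the inverse Kazhdan--Lusztig polynomials of the fan graphs $F_n$, where $F_0$ is the single-vertex graph. Then, as formal power series in $u$, $$\Psi(t,u)=1+\frac{1-4u-\sqrt{1-4tu^2}}{2(-2+4u+tu)}.$$
   Context: All graphs are finite and loopless (parallel edges allowed). For a graph $G$, $c(G)$ is its number of connected components and $\mathrm{rk}(G)=|V(G)|-c(G)$ is the rank of its graphic matroid $\mathsf{M}(G)$. A composition of $G$ is a partition of $V(G)$ into vertex sets of connected induced subgraphs; $\mathcal{C}(G)$ is the set of compositions and $|C|$ is the number of parts of $C$. Compositions correspond bijectively to flats of $\mathsf{M}(G)$: $C$ corresponds to the set of edges with both endpoints in a common part of $C$. For $C\in\mathcal{C}(G)$, $G[C]$ is the subgraph whose edge set is that flat and whose vertices are the endpoints of these edges, with $\mathrm{rk}(G[C])=|V(G)|-|C|$, and $G/C$ is the graph obtained from $G$ by contracting all edges of that flat. $\chi_G(t)$ is the chromatic polynomial of $G$. The inverse Kazhdan--Lusztig polynomials $Q_G(t)\in\mathbb{Z}[t]$ are uniquely determined by: (i) if $\mathrm{rk}(G)=0$ then $Q_G(t)=1$; (ii) if $\mathrm{rk}(G)>0$ then $\deg Q_G(t)<\frac12\mathrm{rk}(G)$ and $$(-t)^{\mathrm{rk}(G)}Q_G(t^{-1})=\sum_{C\in\mathcal{C}(G)}(-1)^{\mathrm{rk}(G[C])}Q_{G[C]}(t)\cdot t^{|C|}\chi_{G/C}(t^{-1}).$$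 For $n\ge1$ the fan graph $F_n$ is the graph on vertices $0,1,\dots,n$ obtained from the path $1,2,\dots,n$ by joining vertex $0$ to every vertex of the path. $\sqrt{1-4tu^2}$ denotes the formal power series square root with constant term $1$. *)

theory Defs
  imports
    "HOL-Library.Disjoint_Sets"
    "HOL-Computational_Algebra.Computational_Algebra"
begin

section \<open>Finite loopless multigraphs\<close>

record ('v, 'e) mgraph =
  verts :: "'v set"
  edges :: "'e set"
  ends  :: "'e \<Rightarrow> 'v set"

text \<open>
  The end sets have two elements, so there are no loops; \<^const>\<open>ends\<close> need not be injective,
  so parallel edges are allowed.
\<close>

definition graph :: "('v, 'e) mgraph \<Rightarrow> bool" where
  "graph G \<longleftrightarrow> finite (verts G) \<and> finite (edges G) \<and>
     (\<forall>e\<in>edges G. ends G e \<subseteq> verts G \<and> card (ends G e) = 2)"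

definition connectivity :: "('v, 'e) mgraph \<Rightarrow> ('v \<times> 'v) set" where
  "connectivity G = {(u, v). \<exists>e\<in>edges G. ends G e = {u, v}}\<^sup>* \<inter> verts G \<times> verts G"

definition components :: "('v, 'e) mgraph \<Rightarrow> 'v set set" where
  "components G = verts G // connectivity G"

definition connected :: "('v, 'e) mgraph \<Rightarrow> bool" where
  "connected G \<longleftrightarrow> card (components G) = 1"

definition rk :: "('v, 'e) mgraph \<Rightarrow> nat" where
  "rk G = card (verts G) - card (components G)"

definition induced :: "('v, 'e) mgraph \<Rightarrow> 'v set \<Rightarrow> ('v, 'e) mgraph" where
  "induced G X = \<lparr>verts = X, edges = {e \<in> edges G. ends G e \<subseteq> X}, ends = ends G\<rparr>"

text \<open>
  Contraction of an edge set \<open>F\<close>: the new vertices are the components of the spanning subgraph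
  with edge set \<open>F\<close>.
\<close>

definition contract :: "('v, 'e) mgraph \<Rightarrow> 'e set \<Rightarrow> ('v set, 'e) mgraph" where
  "contract G F =
     (let K = components (G\<lparr>edges := F\<rparr>)
      in \<lparr>verts = K, edges = edges G - F, ends = (\<lambda>e. {X \<in> K. X \<inter> ends G e \<noteq> {}})\<rparr>)"


section \<open>Compositions\<close>

definition compositions :: "('v, 'e) mgraph \<Rightarrow> 'v set set set" where
  "compositions G = {C. partition_on (verts G) C \<and> (\<forall>X\<in>C. connected (induced G X))}"

definition flat_of :: "('v, 'e) mgraph \<Rightarrow> 'v set set \<Rightarrow> 'e set" where
  "flat_of G C = {e \<in> edges G. \<exists>X\<in>C. ends G e \<subseteq> X}"

text \<open>The graph $G[C]$; vertices of \<open>G\<close> that are singleton parts of \<open>C\<close> are dropped.\<close>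

definition restrict_comp :: "('v, 'e) mgraph \<Rightarrow> 'v set set \<Rightarrow> ('v, 'e) mgraph" where
  "restrict_comp G C =
     \<lparr>verts = (\<Union>e\<in>flat_of G C. ends G e), edges = flat_of G C, ends = ends G\<rparr>"

text \<open>The graph $G/C$.\<close>

definition contract_comp :: "('v, 'e) mgraph \<Rightarrow> 'v set set \<Rightarrow> ('v set, 'e) mgraph" where
  "contract_comp G C = contract G (flat_of G C)"


section \<open>The chromatic polynomial\<close>

definition proper_colorings :: "('v, 'e) mgraph \<Rightarrow> nat \<Rightarrow> ('v \<Rightarrow> nat) set" where
  "proper_colorings G n =
     {f \<in> verts G \<rightarrow>\<^sub>E {..<n}. \<forall>e\<in>edges G. \<forall>u v. ends G e = {u, v} \<longrightarrow> f u \<noteq> f v}"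

definition chromatic_poly :: "('v, 'e) mgraph \<Rightarrow> int poly" where
  "chromatic_poly G = (THE p. \<forall>n. poly p (int n) = int (card (proper_colorings G n)))"


section \<open>Inverse Kazhdan--Lusztig polynomials\<close>

text \<open>
  The identity defining $Q_G$ involves $t^{-1}$; it is stated in the field of fractions of
  the integer polynomials, with \<open>tt\<close> the indeterminate.
\<close>

abbreviation tt :: "int poly fract" where
  "tt \<equiv> to_fract [:0, 1:]"

definition eval_at :: "int poly \<Rightarrow> int poly fract \<Rightarrow> int poly fract" where
  "eval_at p x = poly (map_poly of_int p) x"

text \<open>
  \<open>invKL_at Q G\<close>: the family \<open>Q\<close> satisfies the two defining conditions at the graph \<open>G\<close>.
\<close>

definition invKL_at :: "(('v, 'e) mgraph \<Rightarrow> int poly) \<Rightarrow> ('v, 'e) mgraph \<Rightarrow> bool" where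
  "invKL_at Q G \<longleftrightarrow>
     (rk G = 0 \<longrightarrow> Q G = 1) \<and>
     (rk G > 0 \<longrightarrow>
        real (degree (Q G)) < 1 / 2 * real (rk G) \<and>
        (- tt) ^ rk G * eval_at (Q G) (inverse tt) =
        (\<Sum>C\<in>compositions G.
           (- 1) ^ rk (restrict_comp G C) * eval_at (Q (restrict_comp G C)) tt *
           (tt ^ card C * eval_at (chromatic_poly (contract_comp G C)) (inverse tt))))"

lemma invKL_at_cong [fundef_cong]:
  assumes "G = G'"
    and "\<And>H. H = G' \<or> (\<exists>C\<in>compositions G'. H = restrict_comp G' C) \<Longrightarrow> Q H = Q' H"
  shows "invKL_at Q G \<longleftrightarrow> invKL_at Q' G'"
proof -
  have "Q G' = Q' G'"
    using assms(2) by blast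
  moreover have "Q (restrict_comp G' C) = Q' (restrict_comp G' C)" if "C \<in> compositions G'" for C
    using assms(2) that by blast
  ultimately show ?thesis
    unfolding invKL_at_def assms(1) by (simp cong: sum.cong)
qed

lemma restrict_comp_smaller:
  assumes "graph G" "restrict_comp G C \<noteq> G"
  shows "card (verts (restrict_comp G C)) + card (edges (restrict_comp G C))
           < card (verts G) + card (edges G)"
proof -
  let ?H = "restrict_comp G C"
  have fin: "finite (verts G)" "finite (edges G)"
    using assms(1) by (auto simp: graph_def)
  have sub: "verts ?H \<subseteq> verts G" "edges ?H \<subseteq> edges G"
    using assms(1) by (auto simp: graph_def restrict_comp_def flat_of_def)
  have "verts ?H \<noteq> verts G \<or> edges ?H \<noteq> edges G"
    using assms(2) by (auto simp: restrict_comp_def)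
  then consider "verts ?H \<subset> verts G" | "edges ?H \<subset> edges G"
    using sub by blast
  then show ?thesis
  proof cases
    case 1
    then show ?thesis
      using psubset_card_mono[OF fin(1)] card_mono[OF fin(2) sub(2)] by (simp add: add_less_le_mono)
  next
    case 2
    then show ?thesis
      using psubset_card_mono[OF fin(2)] card_mono[OF fin(1) sub(1)] by (simp add: add_le_less_mono)
  qed
qed

text \<open>
  $Q_G$ is the unique polynomial that satisfies the two conditions at \<open>G\<close> together with the
  polynomials of the smaller graphs $G[C]$. The graph \<open>G\<close> can itself be of the form $G[C]$ (for the
  composition into connected components, if \<open>G\<close> has no isolated vertex), so the unknown \<open>q\<close> occurs
  on both sides of the identity. The value $0$ is only for records that are not graphs.
\<close>

function inverse_KL :: "('v, 'e) mgraph \<Rightarrow> int poly" where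
  "inverse_KL G =
     (if graph G then (THE q. invKL_at (\<lambda>H. if H = G then q else inverse_KL H) G) else 0)"
  by pat_completeness auto
termination
  by (relation "measure (\<lambda>G. card (verts G) + card (edges G))") (auto intro: restrict_comp_smaller)

declare inverse_KL.simps [simp del]


section \<open>Fan graphs\<close>

definition fan :: "nat \<Rightarrow> (nat, nat set) mgraph" where
  "fan n = \<lparr>verts = {0..n},
            edges = {{i, i + 1} | i. 1 \<le> i \<and> i < n} \<union> {{0, i} | i. 1 \<le> i \<and> i \<le> n},
            ends = id\<rparr>"


section \<open>The generating function\<close>

definition Psi :: "int poly fract fps" where
  "Psi = Abs_fps (\<lambda>n. to_fract (inverse_KL (fan n)))"

text \<open>
  The first argument of \<^const>\<open>fps_radical\<close> chooses the root of the constant term; this is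
  the square root with constant term $1$ of a series with constant term $1$.
\<close>

definition fps_sqrt :: "int poly fract fps \<Rightarrow> int poly fract fps" where
  "fps_sqrt f = fps_radical (\<lambda>_ _. 1) 2 f"

end

theory Submission
  imports Defs
begin

text \<open>
  Flats of \<open>F\<^sub>n\<close> are local objects. Each path vertex \<open>i\<close> is joined to the hub \<open>0\<close> in the flat
  (\<open>Spoke\<close>), or, failing that, joined to \<open>i - 1\<close> (\<open>Rim\<close>), or neither (\<open>Free\<close>); the only constraint
  is that a triangle \<open>0, i, i + 1\<close> has none, one or all of its edges in the flat. So flats are
  words in three letters, and a flat is a direct sum of coloops and of smaller fans, one for each
  maximal run of spokes. Since a coloop has polynomial \<open>1\<close>, the polynomial of a flat should be the
  product of the polynomials \<open>q\<^sub>a = Q(F\<^sub>a)\<close> over its run lengths \<open>a\<close>. Colourings of a contraction can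
  be counted one path vertex at a time, so the characteristic polynomials in the recursion are
  products of local factors as well (\<open>card_colorings_word\<close>).

  The polynomial of a graph is determined by those of its smaller flats, because a polynomial of
  degree below \<open>r / 2\<close> and its reversal \<open>t\<^sup>r p(1/t)\<close> have no monomial in common
  (\<open>eval_at_inverse_tt_rigid\<close>). Hence it is enough to check the recursion for the conjectured
  products at every flat of a fan at once (\<open>inverse_KL_eqI\<close>, \<open>inverse_KL_word_graph\<close>). The sum over
  the flats below a given flat factors over its runs. For a single run let \<open>T\<close> be the generating
  function of these sums, \<open>U\<close> that of the part in which the last spoke is absent, and
  \<open>f = \<Psi>(t, -u)\<close>, which carries the signs \<open>(-1)\<^sup>a q\<^sub>a\<close>. Splitting off the last run of spokes gives
  \<open>T = f (1 + U)\<close>, and inspecting the last two vertices gives \<open>U = u (1 - t) T - u (1 + t) U\<close>.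
  The recursion demands \<open>T = \<Psi>(1/t, -t u)\<close>, so what is needed is
  \[\Psi(1/t,-tu)\,(1+u+tu)=\Psi(t,-u)\,\bigl(1+u+tu+u(1-t)\Psi(1/t,-tu)\bigr).\]

  Let \<open>v\<close> be the series with \<open>v = u (1 + t v\<^sup>2)\<close>, which is \<open>u\<close> times the Catalan series at \<open>t u\<^sup>2\<close>.
  The solution is \<open>\<Psi> = (1 - v) / (1 - 2 v)\<close>. Indeed the two substitutions turn \<open>v\<close> into
  series that differ by a factor \<open>t\<close>, and the displayed equation becomes a rational identity
  (\<open>fan_fps_reciprocity\<close>). All monomials of \<open>v\<close> have the form \<open>t\<^sup>j u\<^bsup>2j+1\<^esup>\<close>, which gives the
  degree bound. Finally \<open>1 - 2 t u v\<close> is the square root of \<open>1 - 4 t u\<^sup>2\<close>, which gives the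
  closed form (\<open>specialize_fan_fps_closed\<close>).
\<close>

section \<open>The field of rational functions\<close>

text \<open>
  In characteristic zero a square root of a power series is determined by its constant term. The
  instances make this available over \<^typ>\<open>int poly fract\<close>.
\<close>

instance fract :: ("{idom, ring_char_0}") ring_char_0
proof
  have "of_nat n = to_fract (of_nat n :: 'a)" for n
    by (induction n) simp_all
  then show "inj (of_nat :: nat \<Rightarrow> 'a fract)"
    by (intro injI) simp
qed

instance fract :: ("{idom, ring_char_0}") field_char_0 ..

lemma eval_at_0 [simp]: "eval_at 0 x = 0"
  by (simp add: eval_at_def)

lemma eval_at_pCons [simp]: "eval_at (pCons a p) x = of_int a + x * eval_at p x"
  by (simp add: eval_at_def map_poly_pCons)

lemma eval_at_add: "eval_at (p + q) x = eval_at p x + eval_at q x"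
  by (induction p q rule: poly_induct2) (simp_all add: algebra_simps)

lemma eval_at_1 [simp]: "eval_at 1 x = 1"
  by (simp add: one_pCons)

lemma eval_at_smult: "eval_at (smult a p) x = of_int a * eval_at p x"
  by (induction p) (simp_all add: algebra_simps)

lemma eval_at_mult: "eval_at (p * q) x = eval_at p x * eval_at q x"
  by (induction p) (simp_all add: eval_at_add eval_at_smult algebra_simps)

lemma eval_at_diff: "eval_at (p - q) x = eval_at p x - eval_at q x"
  using eval_at_add[of "p - q" q x] by simp

lemma eval_at_power: "eval_at (p ^ n) x = eval_at p x ^ n"
  by (induction n) (simp_all add: eval_at_mult)

lemma eval_at_sum: "eval_at (\<Sum>i\<in>I. p i) x = (\<Sum>i\<in>I. eval_at (p i) x)"
  by (induction I rule: infinite_finite_induct) (simp_all add: eval_at_add)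

lemma to_fract_of_int: "to_fract [:a:] = of_int a"
proof -
  have nat: "to_fract (of_nat n :: int poly) = of_nat n" for n
    by (induction n) simp_all
  have "to_fract (of_int a :: int poly) = of_int a"
    by (cases a) (simp_all add: nat del: of_nat_Suc)
  then show ?thesis by (simp add: of_int_poly)
qed

lemma eval_at_tt: "eval_at p tt = to_fract p"
proof (induction p)
  case (pCons a p)
  have "to_fract (pCons a p) = to_fract ([:a:] + [:0, 1:] * p)" by simp
  then show ?case
    using pCons by (simp only: eval_at_pCons to_fract_add to_fract_mult to_fract_of_int)
qed simp

lemma eval_at_inverse_tt:
  assumes "degree p \<le> r"
  shows "tt ^ r * eval_at p (inverse tt) = to_fract (monom 1 (r - degree p) * reflect_poly p)"
proof -
  let ?P = "map_poly of_int p :: int poly fract poly"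
  have "tt ^ degree ?P * poly ?P (inverse tt) = poly (reflect_poly ?P) tt"
    by (rule poly_reflect_poly_nz [symmetric]) simp
  moreover have deg: "degree ?P = degree p"
    by (rule degree_map_poly) simp
  moreover have "reflect_poly ?P = map_poly of_int (reflect_poly p)"
    by (rule poly_eqI) (simp add: coeff_reflect_poly coeff_map_poly deg)
  ultimately have "tt ^ degree p * eval_at p (inverse tt) = to_fract (reflect_poly p)"
    by (simp only: eval_at_tt[of "reflect_poly p", symmetric] eval_at_def)
  moreover have "tt ^ r = tt ^ (r - degree p) * tt ^ degree p"
    using assms by (simp only: power_add[symmetric] le_add_diff_inverse2)
  moreover have "to_fract (monom 1 k) = tt ^ k" for k
    using eval_at_power[of "[:0, 1:]" k tt] by (simp only: eval_at_tt monom_altdef smult_1_left)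
  ultimately show ?thesis by (simp only: to_fract_mult mult.assoc)
qed

text \<open>
  A nonzero polynomial of degree below \<open>r / 2\<close> and its reversal \<open>t\<^sup>r p(1/t)\<close> have no
  monomial in common; so the two are proportional only if \<open>p = 0\<close>.
\<close>

lemma eval_at_inverse_tt_rigid:
  assumes "2 * degree p < r"
    and "tt ^ r * eval_at p (inverse tt) = to_fract (smult c p)"
  shows "p = 0"
proof -
  have "monom 1 (r - degree p) * reflect_poly p = smult c p"
    using assms(1) eval_at_inverse_tt[of p r] unfolding assms(2) by (simp only: to_fract_eq_iff)
  then have "coeff (monom 1 (r - degree p) * reflect_poly p) (r - degree p) = c * coeff p (r - degree p)"
    by (simp only: coeff_smult)
  also have "coeff p (r - degree p) = 0"
    using assms(1) by (intro coeff_eq_0) linarith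
  finally have "lead_coeff p = 0"
    unfolding coeff_monom_mult
    by (simp only: less_irrefl if_False diff_self_eq_0 coeff_0_reflect_poly mult_1 mult_zero_right)
  then show ?thesis by simp
qed

section \<open>Colourings with prescribed monochromatic edges\<close>

text \<open>
  Fixing which edges must be monochromatic and which must be proper covers both counts that occur
  in the recursion: colourings of a contraction, and powers of the number of components. It also
  makes deletion and contraction of an edge a move between the last two edge sets, with the
  vertices unchanged.
\<close>

definition colorings ::
  "'v set \<Rightarrow> ('e \<Rightarrow> 'v set) \<Rightarrow> 'e set \<Rightarrow> 'e set \<Rightarrow> nat \<Rightarrow> ('v \<Rightarrow> nat) set" where
  "colorings W d A B k = {f \<in> W \<rightarrow>\<^sub>E {..<k}.
     (\<forall>e\<in>A. \<forall>u v. d e = {u, v} \<longrightarrow> f u = f v) \<and> (\<forall>e\<in>B. \<forall>u v. d e = {u, v} \<longrightarrow> f u \<noteq> f v)}"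

lemma finite_colorings [simp]: "finite W \<Longrightarrow> finite (colorings W d A B k)"
  unfolding colorings_def by (rule finite_subset[of _ "W \<rightarrow>\<^sub>E {..<k}"]) (auto intro: finite_PiE)

lemma ends_in_verts:
  assumes "graph G" "e \<in> edges G" "ends G e = {u, v}"
  shows "u \<in> verts G" "v \<in> verts G"
  using assms unfolding graph_def by (metis insert_subset)+

lemma connectivityI:
  assumes "graph G" "e \<in> edges G" "ends G e = {u, v}"
  shows "(u, v) \<in> connectivity G"
proof -
  have "u \<in> verts G" "v \<in> verts G"
    using ends_in_verts[OF assms] by auto
  moreover have "(u, v) \<in> {(u, v). \<exists>e\<in>edges G. ends G e = {u, v}}"
    using assms by auto
  ultimately show ?thesis
    unfolding connectivity_def by blast
qed

text \<open>
  Used with colourings as \<open>f\<close>, and with membership in a vertex set as \<open>f\<close> to confine a component.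
\<close>

lemma connectivity_invariant:
  assumes "(u, v) \<in> connectivity G"
    and "\<And>e u v. e \<in> edges G \<Longrightarrow> ends G e = {u, v} \<Longrightarrow> f u = f v"
  shows "f u = f v"
proof -
  have "(u, v) \<in> {(u, v). \<exists>e\<in>edges G. ends G e = {u, v}}\<^sup>*"
    using assms(1) by (auto simp: connectivity_def)
  then show ?thesis
    by induction (use assms(2) in auto)
qed

lemma equiv_connectivity: "equiv (verts G) (connectivity G)"
proof -
  let ?R = "{(u, v). \<exists>e\<in>edges G. ends G e = {u, v}}"
  have "sym ?R"
    by (auto simp: sym_def insert_commute)
  then have "sym (?R\<^sup>*)" by (rule sym_rtrancl)
  then show ?thesis
    unfolding connectivity_def
    by (intro equivI) (auto simp: refl_on_def sym_def trans_def intro: rtrancl_trans)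
qed

lemma finite_components: "finite (verts G) \<Longrightarrow> finite (components G)"
  unfolding components_def
  by (rule finite_quotient) (auto simp: connectivity_def)

lemma graph_edges_subset: "graph G \<Longrightarrow> F \<subseteq> edges G \<Longrightarrow> graph (G\<lparr>edges := F\<rparr>)"
  by (auto simp: graph_def intro: finite_subset)

lemma ends_doubleton:
  assumes "graph G" "e \<in> edges G"
  obtains u v where "ends G e = {u, v}" "u \<in> verts G" "v \<in> verts G"
  using assms unfolding graph_def by (auto simp: card_2_iff)

text \<open>
  A colouring of the contraction is pulled back along the map from a vertex to its component.
  An edge outside \<open>F\<close> with both ends in one component becomes a loop of the contraction, and then
  both sides are empty.
\<close>

lemma card_proper_colorings_contract:
  assumes G: "graph G" and F: "F \<subseteq> edges G"
  shows "card (proper_colorings (contract G F) k) =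
    card (colorings (verts G) (ends G) F (edges G - F) k)"
proof -
  define H where "H = G\<lparr>edges := F\<rparr>"
  define K where "K = components H"
  define cl where "cl v = connectivity H `` {v}" for v
  have H: "graph H" "verts H = verts G" "edges H = F" "ends H = ends G"
    using graph_edges_subset[OF G F] by (simp_all add: H_def)
  have eq: "equiv (verts G) (connectivity H)"
    using equiv_connectivity[of H] H by simp
  have clK: "cl v \<in> K" if "v \<in> verts G" for v
    using that by (simp add: K_def components_def cl_def quotientI H)
  have Kcl: "\<exists>v\<in>verts G. X = cl v" if "X \<in> K" for X
    using that by (auto simp: K_def components_def cl_def quotient_def H)
  have cl_eq: "cl u = cl v \<longleftrightarrow> (u, v) \<in> connectivity H" if "u \<in> verts G" "v \<in> verts G" for u v
    unfolding cl_def using eq that by (simp add: eq_equiv_class_iff)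
  have mem: "v \<in> cl u \<longleftrightarrow> cl u = cl v" if "u \<in> verts G" "v \<in> verts G" for u v
    using cl_eq[OF that] by (auto simp: cl_def)
  have memK: "w \<in> X \<longleftrightarrow> X = cl w" if "X \<in> K" "w \<in> verts G" for X w
    using Kcl[OF that(1)] mem that(2) by blast
  have con: "ends (contract G F) e = {cl u, cl v}" if "e \<in> edges G" "ends G e = {u, v}" for e u v
  proof -
    have uv: "u \<in> verts G" "v \<in> verts G"
      using ends_in_verts[OF G, of e u v] that by auto
    have "ends (contract G F) e = {X \<in> K. X \<inter> {u, v} \<noteq> {}}"
      using that by (simp add: contract_def Let_def K_def H_def)
    also have "\<dots> = {cl u, cl v}"
      using uv clK memK by blast
    finally show ?thesis .
  qed
  have verts: "verts (contract G F) = K" "edges (contract G F) = edges G - F"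
    by (simp_all add: contract_def Let_def K_def H_def)
  have "bij_betw (\<lambda>g. restrict (g \<circ> cl) (verts G)) (proper_colorings (contract G F) k)
      (colorings (verts G) (ends G) F (edges G - F) k)" (is "bij_betw ?\<phi> ?P ?Q")
  proof (rule bij_betw_imageI)
    show "inj_on ?\<phi> ?P"
    proof (rule inj_onI)
      fix g h assume gh: "g \<in> ?P" "h \<in> ?P" "?\<phi> g = ?\<phi> h"
      show "g = h"
      proof (rule PiE_ext)
        show "g \<in> K \<rightarrow>\<^sub>E {..<k}" "h \<in> K \<rightarrow>\<^sub>E {..<k}"
          using gh by (auto simp: proper_colorings_def verts)
        fix X assume "X \<in> K"
        then obtain v where "v \<in> verts G" "X = cl v" using Kcl by blast
        then show "g X = h X" using fun_cong[OF gh(3), of v] by simp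
      qed
    qed
    show "?\<phi> ` ?P = ?Q"
    proof (intro subset_antisym subsetI)
      fix f assume "f \<in> ?\<phi> ` ?P"
      then obtain g where g: "g \<in> ?P" "f = ?\<phi> g" by blast
      have "f u = f v" if "e \<in> F" "ends G e = {u, v}" for e u v
      proof -
        have uv: "u \<in> verts G" "v \<in> verts G"
          using ends_in_verts[OF G, of e u v] that F by auto
        moreover have "cl u = cl v"
          using cl_eq[OF uv] connectivityI[of H e u v] that H by simp
        ultimately show ?thesis by (simp add: g)
      qed
      moreover have "f u \<noteq> f v" if "e \<in> edges G - F" "ends G e = {u, v}" for e u v
      proof -
        have uv: "u \<in> verts G" "v \<in> verts G"
          using ends_in_verts[OF G, of e u v] that F by auto
        have "g (cl u) \<noteq> g (cl v)"
          using g(1) that con[of e u v] by (auto simp: proper_colorings_def verts)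
        then show ?thesis using uv by (simp add: g)
      qed
      moreover have "f \<in> verts G \<rightarrow>\<^sub>E {..<k}"
        using g clK by (auto simp: proper_colorings_def verts PiE_def Pi_def)
      ultimately show "f \<in> ?Q"
        by (auto simp: colorings_def)
    next
      fix f assume f: "f \<in> ?Q"
      \<comment> \<open>The colouring \<open>f\<close> is constant on components, so any representative will do.\<close>
      define g where "g = restrict (\<lambda>X. f (SOME v. v \<in> verts G \<and> X = cl v)) K"
      have gcl: "g (cl v) = f v" if v: "v \<in> verts G" for v
      proof -
        let ?w = "SOME w. w \<in> verts G \<and> cl v = cl w"
        have w: "?w \<in> verts G \<and> cl v = cl ?w"
          by (rule someI[of _ v]) (use v in auto)
        then have "(?w, v) \<in> connectivity H"
          using cl_eq[of ?w v] v by metis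
        then have "f ?w = f v"
          by (rule connectivity_invariant) (use f H in \<open>auto simp: colorings_def\<close>)
        then show ?thesis using clK[OF v] by (simp add: g_def)
      qed
      have "g \<in> ?P"
        unfolding proper_colorings_def verts
      proof (intro CollectI conjI ballI allI impI)
        show "g \<in> K \<rightarrow>\<^sub>E {..<k}"
        proof (rule PiE_I)
          fix X assume "X \<in> K"
          then obtain v where "v \<in> verts G" "X = cl v" using Kcl by blast
          then show "g X \<in> {..<k}" using gcl[of v] f by (auto simp: colorings_def)
        qed (simp add: g_def)
        fix e X Y assume e: "e \<in> edges G - F" and XY: "ends (contract G F) e = {X, Y}"
        from e have "e \<in> edges G" by simp
        then obtain u v where uv: "ends G e = {u, v}" "u \<in> verts G" "v \<in> verts G"
          by (rule ends_doubleton[OF G])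
        have "f u \<noteq> f v"
          using f e uv by (auto simp: colorings_def)
        moreover have "{X, Y} = {cl u, cl v}"
          using con[of e u v] e uv XY by simp
        ultimately show "g X \<noteq> g Y"
          using gcl[OF uv(2)] gcl[OF uv(3)] by (auto simp: doubleton_eq_iff)
      qed
      moreover have "?\<phi> g = f"
        using f gcl by (auto simp: colorings_def fun_eq_iff restrict_def PiE_def extensional_def)
      ultimately show "f \<in> ?\<phi> ` ?P" by blast
    qed
  qed
  then show ?thesis by (rule bij_betw_same_card)
qed

text \<open>
  This is how components are counted below: instead of exhibiting them, it suffices to count
  colourings that are constant along edges.
\<close>

lemma card_colorings_components:
  assumes "graph G"
  shows "card (colorings (verts G) (ends G) (edges G) {} k) = k ^ card (components G)"
proof -
  have "proper_colorings (contract G (edges G)) k = components G \<rightarrow>\<^sub>E {..<k}"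
    by (auto simp: proper_colorings_def contract_def Let_def)
  then have "card (proper_colorings (contract G (edges G)) k) = k ^ card (components G)"
    using finite_components[of G] assms by (simp add: card_PiE graph_def)
  then show ?thesis
    using card_proper_colorings_contract[OF assms, of "edges G" k] by simp
qed

text \<open>
  Deletion-contraction: a colouring proper on \<open>B\<close> is either proper or monochromatic at one further
  edge \<open>e\<close>, so \<open>e\<close> can be traded for an additional monochromatic edge, until only components have to
  be counted.
\<close>

lemma colorings_polynomial:
  assumes "finite B" "finite W" "finite A" "\<And>e. e \<in> A \<union> B \<Longrightarrow> d e \<subseteq> W \<and> card (d e) = 2"
  shows "\<exists>p. \<forall>k. poly p (int k) = int (card (colorings W d A B k))"
  using assms
proof (induction B arbitrary: A rule: finite_induct)
  case empty
  let ?G = "\<lparr>verts = W, edges = A, ends = d\<rparr>"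
  have "graph ?G" using empty by (simp add: graph_def)
  from card_colorings_components[OF this]
  have "poly (monom 1 (card (components ?G))) (int k) = int (card (colorings W d A {} k))" for k
    by (simp add: poly_monom)
  then show ?case by blast
next
  case (insert e B)
  obtain p where p: "poly p (int k) = int (card (colorings W d A B k))" for k
    using insert.IH[of A] insert.prems by auto
  obtain q where q: "poly q (int k) = int (card (colorings W d (insert e A) B k))" for k
    using insert.IH[of "insert e A"] insert.prems by auto
  obtain x y where xy: "d e = {x, y}"
    using insert.prems(3)[of e] by (auto simp: card_2_iff)
  then have eq: "(\<forall>u v. d e = {u, v} \<longrightarrow> f u = f v) \<longleftrightarrow> f x = f y"
    and neq: "(\<forall>u v. d e = {u, v} \<longrightarrow> f u \<noteq> f v) \<longleftrightarrow> f x \<noteq> f y" for f :: "'b \<Rightarrow> nat"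
    by (auto simp: doubleton_eq_iff)
  have "colorings W d A B k = colorings W d A (insert e B) k \<union> colorings W d (insert e A) B k"
    and "colorings W d A (insert e B) k \<inter> colorings W d (insert e A) B k = {}" for k
    unfolding colorings_def ball_simps by (auto simp only: eq neq)
  then have "card (colorings W d A B k) =
      card (colorings W d A (insert e B) k) + card (colorings W d (insert e A) B k)" for k
    using insert.prems(1) by (metis card_Un_disjoint finite_colorings)
  then have "poly (p - q) (int k) = int (card (colorings W d A (insert e B) k))" for k
    by (simp add: p q)
  then show ?case by blast
qed

lemma poly_eq_if_eq_on_nats:
  fixes p q :: "int poly"
  assumes "\<And>k. poly p (int k) = poly q (int k)"
  shows "p = q"
proof (rule ccontr)
  assume "p \<noteq> q"
  then have "finite {x. poly (p - q) x = 0}"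
    by (intro poly_roots_finite) simp
  moreover have "range int \<subseteq> {x. poly (p - q) x = 0}"
    using assms by auto
  moreover have "infinite (range int)"
    by (simp add: finite_image_iff)
  ultimately show False using finite_subset by blast
qed

lemma chromatic_poly_contract:
  assumes "graph G" "F \<subseteq> edges G"
  shows "poly (chromatic_poly (contract G F)) (int k) =
    int (card (colorings (verts G) (ends G) F (edges G - F) k))"
proof -
  have "\<exists>p. \<forall>k. poly p (int k) = int (card (colorings (verts G) (ends G) F (edges G - F) k))"
    using assms by (intro colorings_polynomial) (auto simp: graph_def intro: finite_subset)
  then have "\<exists>!p. \<forall>k. poly p (int k) = int (card (proper_colorings (contract G F) k))"
    unfolding card_proper_colorings_contract[OF assms]
    by (metis poly_eq_if_eq_on_nats)
  then have "\<forall>k. poly (chromatic_poly (contract G F)) (int k) = int (card (proper_colorings (contract G F) k))"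
    unfolding chromatic_poly_def by (rule theI')
  then show ?thesis
    by (simp add: card_proper_colorings_contract[OF assms])
qed

text \<open>
  The vertices outside \<open>U\<close> are isolated and can be coloured freely.
\<close>

lemma card_colorings_superset:
  assumes "finite W" "U \<subseteq> W" "\<And>e. e \<in> A \<union> B \<Longrightarrow> d e \<subseteq> U"
  shows "card (colorings W d A B k) = k ^ card (W - U) * card (colorings U d A B k)"
proof -
  have U: "u \<in> U" "v \<in> U" if "e \<in> A \<union> B" "d e = {u, v}" for e u v
    using assms(3)[OF that(1)] that(2) by auto
  define ok :: "('a \<Rightarrow> nat) \<Rightarrow> bool" where "ok f \<longleftrightarrow>
    (\<forall>e\<in>A. \<forall>u v. d e = {u, v} \<longrightarrow> f u = f v) \<and> (\<forall>e\<in>B. \<forall>u v. d e = {u, v} \<longrightarrow> f u \<noteq> f v)" for f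
  have ok: "ok f" if "ok g" "\<And>v. v \<in> U \<Longrightarrow> f v = g v" for f g
    unfolding ok_def
  proof (intro conjI ballI allI impI)
    fix e u v assume "e \<in> A" "d e = {u, v}"
    then show "f u = f v" using that U[of e u v] unfolding ok_def by auto
  next
    fix e u v assume "e \<in> B" "d e = {u, v}"
    then show "f u \<noteq> f v" using that U[of e u v] unfolding ok_def by auto
  qed
  have col: "colorings S d A B k = {f \<in> S \<rightarrow>\<^sub>E {..<k}. ok f}" for S
    by (simp add: colorings_def ok_def)
  have "bij_betw (\<lambda>f. (restrict f (W - U), restrict f U)) (colorings W d A B k)
      (((W - U) \<rightarrow>\<^sub>E {..<k}) \<times> colorings U d A B k)"
  proof (rule bij_betw_byWitness[where f' = "\<lambda>(g, h) v. if v \<in> U then h v else g v"])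
    show "\<forall>f\<in>colorings W d A B k. (case (restrict f (W - U), restrict f U) of
        (g, h) \<Rightarrow> \<lambda>v. if v \<in> U then h v else g v) = f"
      by (auto simp: colorings_def fun_eq_iff PiE_def extensional_def)
    show "\<forall>gh\<in>((W - U) \<rightarrow>\<^sub>E {..<k}) \<times> colorings U d A B k.
       (restrict (case gh of (g, h) \<Rightarrow> \<lambda>v. if v \<in> U then h v else g v) (W - U),
        restrict (case gh of (g, h) \<Rightarrow> \<lambda>v. if v \<in> U then h v else g v) U) = gh"
      by (auto simp: colorings_def fun_eq_iff PiE_def extensional_def)
    show "(\<lambda>f. (restrict f (W - U), restrict f U)) ` colorings W d A B k \<subseteq>
        ((W - U) \<rightarrow>\<^sub>E {..<k}) \<times> colorings U d A B k"
    proof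
      fix x assume "x \<in> (\<lambda>f. (restrict f (W - U), restrict f U)) ` colorings W d A B k"
      then obtain f where f: "x = (restrict f (W - U), restrict f U)" "f \<in> W \<rightarrow>\<^sub>E {..<k}" "ok f"
        by (auto simp: col)
      moreover have "ok (restrict f U)"
        by (rule ok[OF f(3)]) simp
      ultimately show "x \<in> ((W - U) \<rightarrow>\<^sub>E {..<k}) \<times> colorings U d A B k"
        using assms(2) by (auto simp: col)
    qed
    show "(\<lambda>(g, h) v. if v \<in> U then h v else g v) ` (((W - U) \<rightarrow>\<^sub>E {..<k}) \<times> colorings U d A B k)
        \<subseteq> colorings W d A B k"
    proof
      fix x assume "x \<in> (\<lambda>(g, h) v. if v \<in> U then h v else g v) ` (((W - U) \<rightarrow>\<^sub>E {..<k}) \<times> colorings U d A B k)"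
      then obtain g h where gh: "x = (\<lambda>v. if v \<in> U then h v else g v)"
          "g \<in> (W - U) \<rightarrow>\<^sub>E {..<k}" "h \<in> U \<rightarrow>\<^sub>E {..<k}" "ok h"
        by (auto simp: col)
      moreover have "ok x"
        by (rule ok[OF gh(4)]) (simp add: gh(1))
      ultimately show "x \<in> colorings W d A B k"
        using assms(2) by (auto simp: col PiE_def extensional_def)
    qed
  qed
  then have "card (colorings W d A B k) = card (((W - U) \<rightarrow>\<^sub>E {..<k}) \<times> colorings U d A B k)"
    by (rule bij_betw_same_card)
  then show ?thesis
    using assms(1) by (simp add: card_cartesian_product card_PiE)
qed

section \<open>Compositions as flats\<close>

text \<open>
  A flat of the graphic matroid is the set of monochromatic edges of some vertex colouring. This
  description is local in the vertices, which closure under cycles is not.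
\<close>

definition flats :: "('v, 'e) mgraph \<Rightarrow> 'e set set" where
  "flats G = {F. \<exists>f :: 'v \<Rightarrow> nat. F = {e \<in> edges G. \<forall>u v. ends G e = {u, v} \<longrightarrow> f u = f v}}"

lemma components_partition: "partition_on (verts G) (components G)"
  unfolding components_def by (rule partition_on_quotient[OF equiv_connectivity])

text \<open>
  Every vertex of \<open>X\<close> is reached from a fixed one by edges of \<open>F\<close>, and such a walk never leaves \<open>X\<close>.
\<close>

lemma connected_component:
  assumes G: "graph G" and X: "X \<in> components (G\<lparr>edges := F\<rparr>)" and F: "F \<subseteq> edges G"
  shows "connected (induced G X)"
proof -
  define H where "H = G\<lparr>edges := F\<rparr>"
  have H: "graph H" "verts H = verts G" "edges H = F" "ends H = ends G"
    using graph_edges_subset[OF G F] by (simp_all add: H_def)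
  obtain x where x: "x \<in> verts G" "X = connectivity H `` {x}"
    using X by (auto simp: components_def quotient_def H_def)
  have eq: "equiv (verts G) (connectivity H)"
    using equiv_connectivity[of H] H by simp
  have XV: "X \<subseteq> verts G" using x by (auto simp: connectivity_def H)
  have xX: "x \<in> X" using x eq by (auto dest: equiv_class_self)
  let ?I = "induced G X"
  have "(x, y) \<in> {(u, v). \<exists>e\<in>F. ends G e = {u, v}}\<^sup>* \<Longrightarrow> y \<in> X \<and> (x, y) \<in> connectivity ?I" for y
  proof (induction rule: rtrancl_induct)
    case base
    then show ?case using xX by (auto simp: connectivity_def induced_def)
  next
    case (step y z)
    then obtain e where e: "e \<in> F" "ends G e = {y, z}" by blast
    have "(y, z) \<in> connectivity H"
      using connectivityI[of H e y z] e H by simp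
    with step have z: "z \<in> X"
      using eq unfolding x by (auto elim: equivE dest: transD)
    have "(y, z) \<in> {(u, v). \<exists>e\<in>edges ?I. ends ?I e = {u, v}}"
      using step.IH z e F by (auto simp: induced_def)
    then have "(y, z) \<in> connectivity ?I"
      using step.IH z unfolding connectivity_def by (auto simp: induced_def)
    then show ?case
      using z step.IH equiv_connectivity[of ?I] by (auto elim: equivE dest: transD)
  qed
  then have "(x, y) \<in> connectivity ?I" if "y \<in> X" for y
    using that by (auto simp: x connectivity_def H)
  then have "X \<subseteq> connectivity ?I `` {x}" by auto
  moreover have "connectivity ?I `` {x} \<subseteq> X"
    by (auto simp: connectivity_def induced_def)
  ultimately have X_eq: "connectivity ?I `` {x} = X" by blast
  have "components ?I = {X}"
  proof -
    have "connectivity ?I `` {y} = X" if "y \<in> X" for y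
      using equiv_class_eq[OF equiv_connectivity, of x y ?I] X_eq that by auto
    then show ?thesis
      using xX by (auto simp: components_def quotient_def induced_def)
  qed
  then show ?thesis by (simp add: connected_def)
qed

lemma composition_partD:
  assumes "C \<in> compositions G"
  shows "partition_on (verts G) C" "X \<in> C \<Longrightarrow> connected (induced G X)"
  using assms by (auto simp: compositions_def)

text \<open>
  A flat edge stays inside a part, and a part is connected by edges that it induces, which are
  flat edges.
\<close>

lemma components_flat_of:
  assumes G: "graph G" and C: "C \<in> compositions G"
  shows "components (G\<lparr>edges := flat_of G C\<rparr>) = C"
proof -
  define H where "H = G\<lparr>edges := flat_of G C\<rparr>"
  have F: "flat_of G C \<subseteq> edges G" by (auto simp: flat_of_def)
  have H: "graph H" "verts H = verts G" "edges H = flat_of G C" "ends H = ends G"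
    using graph_edges_subset[OF G F] by (simp_all add: H_def)
  note part = composition_partD(1)[OF C]
  have cls: "connectivity H `` {x} = X" if "X \<in> C" "x \<in> X" for x X
  proof
    have XV: "X \<subseteq> verts G" using part that by (auto simp: partition_on_def)
    show "connectivity H `` {x} \<subseteq> X"
    proof
      fix y assume "y \<in> connectivity H `` {x}"
      then have "(x, y) \<in> connectivity H" by simp
      then have "(x \<in> X) = (y \<in> X)"
      proof (rule connectivity_invariant)
        fix e u v assume "e \<in> edges H" "ends H e = {u, v}"
        then obtain Y where Y: "Y \<in> C" "u \<in> Y" "v \<in> Y" by (auto simp: H flat_of_def)
        then show "(u \<in> X) = (v \<in> X)"
          using partition_onD2[OF part] that(1) by (auto simp: disjoint_def)
      qed
      then show "y \<in> X" using that by simp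
    qed
    show "X \<subseteq> connectivity H `` {x}"
    proof
      fix y assume y: "y \<in> X"
      let ?I = "induced G X"
      have "card (components ?I) = 1"
        using composition_partD(2)[OF C that(1)] by (simp add: connected_def)
      moreover have "connectivity ?I `` {x} \<in> components ?I" "connectivity ?I `` {y} \<in> components ?I"
        using that y by (auto simp: components_def induced_def intro!: quotientI)
      ultimately have "connectivity ?I `` {x} = connectivity ?I `` {y}"
        by (auto simp: card_1_singleton_iff)
      then have "(x, y) \<in> connectivity ?I"
        using that y by (intro eq_equiv_class[OF _ equiv_connectivity]) (auto simp: induced_def)
      moreover have "{(u, v). \<exists>e\<in>edges ?I. ends ?I e = {u, v}} \<subseteq> {(u, v). \<exists>e\<in>edges H. ends H e = {u, v}}"
        using that by (auto simp: induced_def H flat_of_def)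
      then have "{(u, v). \<exists>e\<in>edges ?I. ends ?I e = {u, v}}\<^sup>* \<subseteq> {(u, v). \<exists>e\<in>edges H. ends H e = {u, v}}\<^sup>*"
        by (rule rtrancl_mono)
      ultimately have "(x, y) \<in> connectivity H"
        using XV that y by (auto simp: connectivity_def H)
      then show "y \<in> connectivity H `` {x}" by simp
    qed
  qed
  have "components H = (\<lambda>x. connectivity H `` {x}) ` verts G"
    by (auto simp: components_def quotient_def H)
  also have "\<dots> = C"
  proof (intro subset_antisym subsetI)
    fix X assume "X \<in> (\<lambda>x. connectivity H `` {x}) ` verts G"
    then obtain x where "x \<in> verts G" "X = connectivity H `` {x}" by blast
    then show "X \<in> C" using cls partition_onD1[OF part] by auto
  next
    fix X assume X: "X \<in> C"
    then obtain x where "x \<in> X" using partition_onD3[OF part] by fastforce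
    then show "X \<in> (\<lambda>x. connectivity H `` {x}) ` verts G"
      using cls[OF X] X partition_onD1[OF part] by blast
  qed
  finally show ?thesis by (simp add: H_def)
qed

text \<open>
  Colour each vertex by a number that identifies its part.
\<close>

lemma flat_of_flat:
  assumes G: "graph G" and C: "C \<in> compositions G"
  shows "flat_of G C \<in> flats G"
proof -
  note part = composition_partD(1)[OF C]
  have "finite (verts G)" using G by (simp add: graph_def)
  then have "finite C" using part finite_elements by blast
  then obtain idx :: "'a set \<Rightarrow> nat" where idx: "inj_on idx C"
    using finite_imp_inj_to_nat_seg by blast
  define pt where "pt v = (THE X. X \<in> C \<and> v \<in> X)" for v
  have pt: "pt v = X" if "X \<in> C" "v \<in> X" for v X
    unfolding pt_def using that partition_onD2[OF part]
    by (intro the_equality) (auto simp: disjoint_def)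
  have ptC: "pt v \<in> C \<and> v \<in> pt v" if "v \<in> verts G" for v
    using that pt partition_onD1[OF part] by (metis UnionE)
  have "flat_of G C = {e \<in> edges G. \<forall>u v. ends G e = {u, v} \<longrightarrow> idx (pt u) = idx (pt v)}"
  proof (intro subset_antisym subsetI CollectI conjI allI impI)
    fix e assume e: "e \<in> flat_of G C"
    then show "e \<in> edges G" by (simp add: flat_of_def)
    fix u v assume "ends G e = {u, v}"
    then show "idx (pt u) = idx (pt v)"
      using e pt by (auto simp: flat_of_def)
  next
    fix e assume e: "e \<in> {e \<in> edges G. \<forall>u v. ends G e = {u, v} \<longrightarrow> idx (pt u) = idx (pt v)}"
    then have "e \<in> edges G" by simp
    then obtain u v where uv: "ends G e = {u, v}" "u \<in> verts G" "v \<in> verts G"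
      by (rule ends_doubleton[OF G])
    have "\<forall>u v. ends G e = {u, v} \<longrightarrow> idx (pt u) = idx (pt v)" using e by simp
    then have "idx (pt u) = idx (pt v)" using uv(1) by metis
    then have "pt u = pt v" using inj_onD[OF idx] ptC[OF uv(2)] ptC[OF uv(3)] by blast
    then have "ends G e \<subseteq> pt u" "pt u \<in> C"
      using uv(1) ptC[OF uv(2)] ptC[OF uv(3)] by auto
    then show "e \<in> flat_of G C" using e by (auto simp: flat_of_def)
  qed
  then show ?thesis
    unfolding flats_def by (intro CollectI exI[of _ "\<lambda>v. idx (pt v)"])
qed

lemma flat_composition:
  assumes G: "graph G" and F: "F \<in> flats G"
  shows "components (G\<lparr>edges := F\<rparr>) \<in> compositions G" "flat_of G (components (G\<lparr>edges := F\<rparr>)) = F"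
proof -
  define H where "H = G\<lparr>edges := F\<rparr>"
  obtain f :: "'a \<Rightarrow> nat" where f: "F = {e \<in> edges G. \<forall>u v. ends G e = {u, v} \<longrightarrow> f u = f v}"
    using F by (auto simp: flats_def)
  then have FE: "F \<subseteq> edges G" by blast
  have H: "graph H" "verts H = verts G" "edges H = F" "ends H = ends G"
    using graph_edges_subset[OF G FE] by (simp_all add: H_def)
  show "components (G\<lparr>edges := F\<rparr>) \<in> compositions G"
    using components_partition[of H] connected_component[OF G _ FE] H
    by (auto simp: compositions_def H_def)
  have "flat_of G (components H) = F"
  proof (intro subset_antisym subsetI)
    fix e assume "e \<in> flat_of G (components H)"
    then obtain X where e: "e \<in> edges G" "X \<in> components H" "ends G e \<subseteq> X"
      by (auto simp: flat_of_def)
    have "f u = f v" if "ends G e = {u, v}" for u v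
    proof -
      have "(u, v) \<in> connectivity H"
        using in_quotient_imp_in_rel[OF equiv_connectivity, of X H u v] e that
        by (auto simp: components_def)
      then show ?thesis
        by (rule connectivity_invariant) (use f H in auto)
    qed
    then show "e \<in> F" using e(1) by (simp add: f)
  next
    fix e assume e: "e \<in> F"
    then have "e \<in> edges G" using FE by blast
    then obtain u v where uv: "ends G e = {u, v}" "u \<in> verts G" "v \<in> verts G"
      by (rule ends_doubleton[OF G])
    then have "(u, v) \<in> connectivity H"
      using connectivityI[of H e u v] H e by simp
    moreover have "u \<in> connectivity H `` {u}"
      using equiv_class_self[OF equiv_connectivity, of u H] uv H by simp
    moreover have "connectivity H `` {u} \<in> components H"
      using uv H by (auto simp: components_def intro: quotientI)
    ultimately have "\<exists>X\<in>components H. ends G e \<subseteq> X"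
      using uv by auto
    then show "e \<in> flat_of G (components H)"
      using e FE by (auto simp: flat_of_def)
  qed
  then show "flat_of G (components (G\<lparr>edges := F\<rparr>)) = F" by (simp add: H_def)
qed

lemma bij_betw_flat_of:
  assumes "graph G"
  shows "bij_betw (flat_of G) (compositions G) (flats G)"
proof (rule bij_betw_byWitness[where f' = "\<lambda>F. components (G\<lparr>edges := F\<rparr>)"])
  show "\<forall>C\<in>compositions G. components (G\<lparr>edges := flat_of G C\<rparr>) = C"
    using components_flat_of[OF assms] by blast
  show "\<forall>F\<in>flats G. flat_of G (components (G\<lparr>edges := F\<rparr>)) = F"
    using flat_composition(2)[OF assms] by blast
qed (use flat_of_flat[OF assms] flat_composition(1)[OF assms] in auto)

section \<open>The defining recursion over flats\<close>

lemma finite_flats: "graph G \<Longrightarrow> finite (flats G)"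
  by (rule finite_subset[of _ "Pow (edges G)"]) (auto simp: flats_def graph_def)

lemma edges_flat: "edges G \<in> flats G"
  unfolding flats_def by (intro CollectI exI[of _ "\<lambda>_. 0"]) simp

lemma card_components_le: "graph G \<Longrightarrow> card (components G) \<le> card (verts G)"
proof -
  assume "graph G"
  then have "card ((\<lambda>v. connectivity G `` {v}) ` verts G) \<le> card (verts G)"
    by (intro card_image_le) (simp add: graph_def)
  moreover have "components G = (\<lambda>v. connectivity G `` {v}) ` verts G"
    by (auto simp: components_def quotient_def)
  ultimately show ?thesis by simp
qed

definition edge_sub :: "('v, 'e) mgraph \<Rightarrow> 'e set \<Rightarrow> ('v, 'e) mgraph" where
  "edge_sub G F = \<lparr>verts = (\<Union>e\<in>F. ends G e), edges = F, ends = ends G\<rparr>"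

lemma edges_edge_sub: "edges (edge_sub G F) = F"
  by (simp add: edge_sub_def)

lemma graph_edge_sub: "graph G \<Longrightarrow> F \<subseteq> edges G \<Longrightarrow> graph (edge_sub G F)"
  unfolding graph_def edge_sub_def by (auto intro: finite_subset)

text \<open>
  Comparing colourings with two colours avoids matching up the components of two different graphs.
\<close>

lemma card_components_edge_sub:
  assumes G: "graph G" and F: "F \<subseteq> edges G"
  shows "card (components (G\<lparr>edges := F\<rparr>)) =
    card (verts G - verts (edge_sub G F)) + card (components (edge_sub G F))"
proof -
  have "card (colorings (verts G) (ends G) F {} 2) =
      2 ^ card (verts G - verts (edge_sub G F)) * card (colorings (verts (edge_sub G F)) (ends G) F {} 2)"
    by (rule card_colorings_superset) (use G F in \<open>auto simp: graph_def edge_sub_def\<close>)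
  moreover have "card (colorings (verts G) (ends G) F {} 2) = 2 ^ card (components (G\<lparr>edges := F\<rparr>))"
    using card_colorings_components[OF graph_edges_subset[OF G F], of 2] by simp
  moreover have "card (colorings (verts (edge_sub G F)) (ends G) F {} 2) = 2 ^ card (components (edge_sub G F))"
    using card_colorings_components[OF graph_edge_sub[OF G F], of 2] by (simp add: edge_sub_def)
  ultimately have "(2::nat) ^ card (components (G\<lparr>edges := F\<rparr>)) =
      2 ^ (card (verts G - verts (edge_sub G F)) + card (components (edge_sub G F)))"
    by (simp add: power_add)
  then show ?thesis by (simp only: power_inject_exp)
qed

lemma rk_edge_sub:
  assumes G: "graph G" and F: "F \<subseteq> edges G"
  shows "rk (edge_sub G F) + card (components (G\<lparr>edges := F\<rparr>)) = card (verts G)"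
proof -
  have "verts (edge_sub G F) \<subseteq> verts G" "finite (verts G)"
    using G F by (auto simp: graph_def edge_sub_def)
  then have "card (verts G) = card (verts G - verts (edge_sub G F)) + card (verts (edge_sub G F))"
    by (metis add.commute card_mono card_Diff_subset finite_subset le_add_diff_inverse)
  moreover have "rk (edge_sub G F) + card (components (edge_sub G F)) = card (verts (edge_sub G F))"
    using card_components_le[OF graph_edge_sub[OF G F]] by (simp add: rk_def)
  ultimately show ?thesis
    using card_components_edge_sub[OF G F] by linarith
qed

text \<open>
  The factor \<open>t\<^bsup>|C|\<^esup> \<chi>(1/t)\<close> of the recursion, with the composition \<open>C\<close> expressed through its flat.
\<close>

definition contraction_weight :: "('v, 'e) mgraph \<Rightarrow> 'e set \<Rightarrow> int poly fract" where
  "contraction_weight G F =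
     tt ^ card (components (G\<lparr>edges := F\<rparr>)) * eval_at (chromatic_poly (contract G F)) (inverse tt)"

lemma sum_compositions_eq_sum_flats:
  assumes G: "graph G"
  shows "(\<Sum>C\<in>compositions G.
           (- 1) ^ rk (restrict_comp G C) * eval_at (Q (restrict_comp G C)) tt *
           (tt ^ card C * eval_at (chromatic_poly (contract_comp G C)) (inverse tt))) =
    (\<Sum>F\<in>flats G. (- 1) ^ rk (edge_sub G F) * to_fract (Q (edge_sub G F)) * contraction_weight G F)"
proof -
  have "(\<Sum>F\<in>flats G. (- 1) ^ rk (edge_sub G F) * to_fract (Q (edge_sub G F)) * contraction_weight G F) =
    (\<Sum>C\<in>compositions G. (- 1) ^ rk (edge_sub G (flat_of G C)) *
       to_fract (Q (edge_sub G (flat_of G C))) * contraction_weight G (flat_of G C))"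
    by (rule sum.reindex_bij_betw [OF bij_betw_flat_of[OF G], symmetric])
  also have "\<dots> = (\<Sum>C\<in>compositions G.
           (- 1) ^ rk (restrict_comp G C) * eval_at (Q (restrict_comp G C)) tt *
           (tt ^ card C * eval_at (chromatic_poly (contract_comp G C)) (inverse tt)))"
  proof (rule sum.cong[OF refl])
    fix C assume "C \<in> compositions G"
    from components_flat_of[OF G this]
    show "(- 1) ^ rk (edge_sub G (flat_of G C)) * to_fract (Q (edge_sub G (flat_of G C))) *
        contraction_weight G (flat_of G C) =
      (- 1) ^ rk (restrict_comp G C) * eval_at (Q (restrict_comp G C)) tt *
           (tt ^ card C * eval_at (chromatic_poly (contract_comp G C)) (inverse tt))"
      by (simp only: contraction_weight_def edge_sub_def restrict_comp_def contract_comp_def eval_at_tt)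
  qed
  finally show ?thesis ..
qed

lemma invKL_at_iff_flats:
  assumes "graph G"
  shows "invKL_at Q G \<longleftrightarrow> (rk G = 0 \<longrightarrow> Q G = 1) \<and>
     (rk G > 0 \<longrightarrow> 2 * degree (Q G) < rk G \<and>
        (- tt) ^ rk G * eval_at (Q G) (inverse tt) =
        (\<Sum>F\<in>flats G. (- 1) ^ rk (edge_sub G F) * to_fract (Q (edge_sub G F)) * contraction_weight G F))"
proof -
  have "real (degree (Q G)) < 1 / 2 * real (rk G) \<longleftrightarrow> 2 * degree (Q G) < rk G"
    by linarith
  then show ?thesis
    unfolding invKL_at_def sum_compositions_eq_sum_flats[OF assms] by (rule arg_cong)
qed

text \<open>
  Contracting all edges leaves \<open>c\<close> isolated vertices, where \<open>t\<^sup>c \<chi>(1/t) = t\<^sup>c t\<^bsup>-c\<^esup>\<close>.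
\<close>

lemma contraction_weight_edges:
  assumes "graph G"
  shows "contraction_weight G (edges G) = 1"
proof -
  have "chromatic_poly (contract G (edges G)) = monom 1 (card (components G))"
  proof (rule poly_eq_if_eq_on_nats)
    fix k
    show "poly (chromatic_poly (contract G (edges G))) (int k) = poly (monom 1 (card (components G))) (int k)"
      using chromatic_poly_contract[OF assms subset_refl, of k] card_colorings_components[OF assms, of k]
      by (simp add: poly_monom)
  qed
  moreover have "eval_at (monom 1 n) x = x ^ n" for n x
    using eval_at_power[of "[:0, 1:]" n x] by (simp add: monom_altdef)
  ultimately show ?thesis
    by (simp add: contraction_weight_def flip: power_mult_distrib)
qed

text \<open>
  The recursions for two solutions differ only in the terms whose flat gives back \<open>G\<close> itself. That
  is at most the term of the full edge set, and it occurs exactly if \<open>G\<close> has no isolated vertex. So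
  the reversal of \<open>q - q'\<close> is either \<open>q - q'\<close> or zero; rigidity settles both cases.
\<close>

lemma invKL_at_unique:
  assumes G: "graph G"
    and q: "invKL_at (\<lambda>H. if H = G then q else R H) G"
    and q': "invKL_at (\<lambda>H. if H = G then q' else R H) G"
  shows "q = q'"
proof (cases "rk G = 0")
  case True
  then show ?thesis using q q' by (simp add: invKL_at_def)
next
  case False
  define r where "r = rk G"
  define S where "S p = (\<Sum>F\<in>flats G. (- 1) ^ rk (edge_sub G F) *
      to_fract (if edge_sub G F = G then p else R (edge_sub G F)) * contraction_weight G F)" for p
  \<comment> \<open>With an isolated vertex, \<open>G\<close> does not occur on the right-hand side of its own recursion.\<close>
  define c :: int where "c = (if edge_sub G (edges G) = G then 1 else 0)"
  have eqs: "2 * degree q < r" "(- tt) ^ r * eval_at q (inverse tt) = S q"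
    "2 * degree q' < r" "(- tt) ^ r * eval_at q' (inverse tt) = S q'"
    using q q' False unfolding invKL_at_iff_flats[OF G] S_def r_def by simp_all
  have "S q - S q' = (\<Sum>F\<in>flats G. if F = edges G then (- 1) ^ r * to_fract (smult c (q - q')) else 0)"
    unfolding S_def sum_subtractf[symmetric]
  proof (rule sum.cong[OF refl])
    fix F
    show "(- 1) ^ rk (edge_sub G F) * to_fract (if edge_sub G F = G then q else R (edge_sub G F)) *
        contraction_weight G F -
      (- 1) ^ rk (edge_sub G F) * to_fract (if edge_sub G F = G then q' else R (edge_sub G F)) *
        contraction_weight G F =
      (if F = edges G then (- 1) ^ r * to_fract (smult c (q - q')) else 0)"
    proof (cases "edge_sub G F = G")
      case True
      then have "F = edges G"
        by (metis edges_edge_sub)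
      with True have "c = 1" by (simp add: c_def)
      show ?thesis
        unfolding \<open>F = edges G\<close>
        using True by (simp add: \<open>F = edges G\<close> \<open>c = 1\<close> r_def contraction_weight_edges[OF G] right_diff_distrib)
    next
      case False
      then show ?thesis by (cases "F = edges G") (simp_all add: c_def)
    qed
  qed
  also have "\<dots> = (- 1) ^ r * to_fract (smult c (q - q'))"
    using finite_flats[OF G] edges_flat[of G] by simp
  finally have "(- tt) ^ r * eval_at (q - q') (inverse tt) = (- 1) ^ r * to_fract (smult c (q - q'))"
    using eqs by (simp add: eval_at_diff right_diff_distrib)
  then have "(- 1) ^ r * (tt ^ r * eval_at (q - q') (inverse tt)) = (- 1) ^ r * to_fract (smult c (q - q'))"
    by (simp only: power_minus[of tt] mult.assoc)
  then have "tt ^ r * eval_at (q - q') (inverse tt) = to_fract (smult c (q - q'))"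
    by (simp only: mult_cancel_left) simp
  moreover have "2 * degree (q - q') < r"
    using degree_diff_le_max[of q q'] eqs by linarith
  ultimately have "q - q' = 0" by (rule eval_at_inverse_tt_rigid[rotated])
  then show ?thesis by simp
qed

text \<open>
  Any family that solves the recursion on a class of graphs closed under passing to flats is the
  family of inverse Kazhdan--Lusztig polynomials there.
\<close>

lemma inverse_KL_eqI:
  assumes "G \<in> \<G>"
    and sub: "\<And>G F. G \<in> \<G> \<Longrightarrow> F \<in> flats G \<Longrightarrow> edge_sub G F \<in> \<G>"
    and graph: "\<And>G. G \<in> \<G> \<Longrightarrow> graph G"
    and Q: "\<And>G. G \<in> \<G> \<Longrightarrow> invKL_at Q G"
  shows "inverse_KL G = Q G"
  using \<open>G \<in> \<G>\<close>
proof (induction "card (verts G) + card (edges G)" arbitrary: G rule: less_induct)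
  case less
  note G = graph[OF less.prems]
  let ?R = "\<lambda>q H. if H = G then q else inverse_KL H"
  have "?R (Q G) H = Q H" if H: "H = G \<or> (\<exists>C\<in>compositions G. H = restrict_comp G C)" for H
  proof (cases "H = G")
    case False
    then obtain C where C: "C \<in> compositions G" "H = restrict_comp G C" using H by blast
    have "H = edge_sub G (flat_of G C)"
      using C(2) by (simp add: restrict_comp_def edge_sub_def)
    then have "H \<in> \<G>"
      using sub[OF less.prems] flat_of_flat[OF G C(1)] by simp
    then show ?thesis
      using less.hyps restrict_comp_smaller[OF G, of C] False C(2) by simp
  qed simp
  then have "invKL_at (?R (Q G)) G \<longleftrightarrow> invKL_at Q G"
    by (intro invKL_at_cong) auto
  then have "(THE q. invKL_at (?R q) G) = Q G"
    using Q[OF less.prems] invKL_at_unique[OF G] by (intro the_equality) blast+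
  then show ?case
    using G by (subst inverse_KL.simps) simp
qed

text \<open>
  An isolated vertex multiplies \<open>\<chi>\<close> by the indeterminate and adds one component, and these cancel
  because \<open>\<chi>\<close> is evaluated at \<open>1/t\<close>. So the vertices that the restriction to a flat drops may be kept
  when weights are computed.
\<close>

lemma contraction_weight_isolated:
  assumes G: "graph G" and W: "finite W" "verts G \<subseteq> W" and F: "F \<subseteq> edges G"
  shows "contraction_weight (G\<lparr>verts := W\<rparr>) F = contraction_weight G F"
proof -
  define H where "H = G\<lparr>verts := W\<rparr>"
  have H: "graph H" "verts H = W" "edges H = edges G" "ends H = ends G"
    using G W by (auto simp: graph_def H_def)
  define m where "m = card (W - verts G)"
  have FH: "F \<subseteq> edges H" using F H by simp
  have "chromatic_poly (contract H F) = [:0, 1:] ^ m * chromatic_poly (contract G F)"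
  proof (rule poly_eq_if_eq_on_nats)
    fix k
    have "card (colorings W (ends G) F (edges G - F) k) =
        k ^ m * card (colorings (verts G) (ends G) F (edges G - F) k)"
      unfolding m_def by (rule card_colorings_superset) (use G W F in \<open>auto simp: graph_def\<close>)
    then show "poly (chromatic_poly (contract H F)) (int k) =
        poly ([:0, 1:] ^ m * chromatic_poly (contract G F)) (int k)"
      using chromatic_poly_contract[OF H(1) FH, of k] chromatic_poly_contract[OF G F, of k]
      by (simp add: H)
  qed
  moreover have "card (components (H\<lparr>edges := F\<rparr>)) = m + card (components (G\<lparr>edges := F\<rparr>))"
  proof -
    have "edge_sub H F = edge_sub G F" by (simp add: edge_sub_def H)
    then have "rk (edge_sub G F) + card (components (H\<lparr>edges := F\<rparr>)) = card W"
      using rk_edge_sub[OF H(1) FH] by (simp add: H)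
    moreover have "rk (edge_sub G F) + card (components (G\<lparr>edges := F\<rparr>)) = card (verts G)"
      by (rule rk_edge_sub[OF G F])
    moreover have "card W = m + card (verts G)"
      unfolding m_def using W by (metis card_Diff_subset card_mono finite_subset le_add_diff_inverse2)
    ultimately show ?thesis by linarith
  qed
  moreover have "tt ^ m * inverse tt ^ m = 1"
    by (simp flip: power_mult_distrib)
  then have "tt ^ (m + c) * (inverse tt ^ m * z) = tt ^ c * z" for c z
    by (metis (no_types, lifting) mult.assoc mult.commute mult_1 power_add)
  ultimately show ?thesis
    unfolding contraction_weight_def H_def[symmetric] by (simp add: eval_at_mult eval_at_power)
qed

section \<open>Flats of fans as words\<close>

text \<open>
  A word describes a flat of a fan from its last path vertex to the hub: the head of the list is
  vertex \<open>n\<close>, where \<open>n\<close> is the length. In this order adding a vertex is adding a letter, and the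
  neighbour of the new vertex is the previous head.
\<close>

datatype letter = Spoke | Rim | Free

abbreviation spoke_top :: "letter list \<Rightarrow> bool" where
  "spoke_top w \<equiv> w \<noteq> [] \<and> hd w = Spoke"

text \<open>
  A rim edge at a vertex that is not joined to the hub leads to another such vertex, since otherwise
  the triangle would force the spoke.
\<close>

fun admissible :: "letter list \<Rightarrow> bool" where
  "admissible [] \<longleftrightarrow> True"
| "admissible (x # w) \<longleftrightarrow> admissible w \<and> (x = Rim \<longrightarrow> w \<noteq> [] \<and> hd w \<noteq> Spoke)"

text \<open>
  The edges from the new vertex \<open>length w + 1\<close> to earlier vertices. Two consecutive spokes bring
  the rim edge between them with them, because they span a triangle.
\<close>

definition last_edges :: "letter \<Rightarrow> letter list \<Rightarrow> nat set set" where
  "last_edges x w =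
     (case x of
        Spoke \<Rightarrow> insert {0, Suc (length w)} (if spoke_top w then {{length w, Suc (length w)}} else {})
      | Rim \<Rightarrow> {{length w, Suc (length w)}}
      | Free \<Rightarrow> {})"

primrec word_edges :: "letter list \<Rightarrow> nat set set" where
  "word_edges [] = {}"
| "word_edges (x # w) = word_edges w \<union> last_edges x w"

text \<open>
  The words of the flats contained in the flat of a given word. Below a spoke a rim edge is possible
  only if it belongs to the larger flat and the smaller flat avoids the spoke of the previous vertex.
\<close>

fun subwords :: "letter list \<Rightarrow> letter list set" where
  "subwords [] = {[]}"
| "subwords (x # w) = (#) Free ` subwords w \<union>
     (case x of
        Spoke \<Rightarrow> (#) Spoke ` subwords w \<union>
          (if spoke_top w then (#) Rim ` {v \<in> subwords w. hd v \<noteq> Spoke} else {})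
      | Rim \<Rightarrow> (#) Rim ` subwords w
      | Free \<Rightarrow> {})"

lemma length_subword: "v \<in> subwords w \<Longrightarrow> length v = length w"
  by (induction w arbitrary: v) (auto split: letter.splits if_splits)

lemma finite_subwords: "finite (subwords w)"
  by (induction w) (auto split: letter.splits)

lemma self_subword: "w \<in> subwords w"
  by (induction w) (auto split: letter.splits)

lemma hd_subword: "v \<in> subwords w \<Longrightarrow> spoke_top v \<Longrightarrow> spoke_top w"
  by (cases w) (auto split: letter.splits if_splits)

lemma subword_Cons:
  assumes "y # v \<in> subwords (x # w)"
  shows "v \<in> subwords w"
    and "y = Spoke \<Longrightarrow> x = Spoke"
    and "y = Rim \<Longrightarrow> x = Rim \<or> x = Spoke \<and> spoke_top w \<and> hd v \<noteq> Spoke"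
  using assms by (auto split: letter.splits if_splits)

lemma subword_not_Nil:
  assumes "v \<in> subwords (x # w)"
  obtains y u where "v = y # u"
  using length_subword[OF assms] by (cases v) auto

lemma admissible_subword: "admissible w \<Longrightarrow> v \<in> subwords w \<Longrightarrow> admissible v"
proof (induction w arbitrary: v)
  case (Cons x w)
  obtain y u where v: "v = y # u" by (rule subword_not_Nil[OF Cons.prems(2)])
  note sub = subword_Cons[OF Cons.prems(2)[unfolded v]]
  have "length u = length w" using sub(1) by (rule length_subword)
  then have "u = [] \<longleftrightarrow> w = []" by auto
  then show ?case
    using Cons sub hd_subword[OF sub(1)] by (auto simp: v)
qed simp

lemma last_edges_subset: "e \<in> last_edges x w \<Longrightarrow> \<exists>i\<le>length w. e = {i, Suc (length w)}"
  by (auto simp: last_edges_def split: letter.splits if_splits)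

text \<open>
  The bound separates the edges at a new vertex from all earlier ones.
\<close>

lemma word_edges_bound: "e \<in> word_edges w \<Longrightarrow> e \<subseteq> {0..length w} \<and> card e = 2"
proof (induction w)
  case (Cons x w)
  then show ?case
    using last_edges_subset[of e x w] by fastforce
qed simp

lemma last_edges_not_earlier: "e \<in> last_edges x w \<Longrightarrow> e \<notin> word_edges v" if "length v = length w"
  using word_edges_bound[of e v] last_edges_subset[of e x w] that by fastforce

lemma finite_word_edges: "finite (word_edges w)"
  by (rule finite_subset[of _ "Pow {0..length w}"]) (use word_edges_bound in auto)

lemma subword_edges: "v \<in> subwords w \<Longrightarrow> word_edges v \<subseteq> word_edges w"
proof (induction w arbitrary: v)
  case (Cons x w)
  obtain y u where v: "v = y # u" by (rule subword_not_Nil[OF Cons.prems])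
  note sub = subword_Cons[OF Cons.prems[unfolded v]]
  have "length u = length w" using sub(1) by (rule length_subword)
  then have "last_edges y u \<subseteq> last_edges x w"
    using sub hd_subword[OF sub(1)] by (cases y) (auto simp: last_edges_def)
  then show ?case using Cons.IH[OF sub(1)] by (auto simp: v)
qed simp

lemma last_edges_Spoke_iff:
  "admissible (x # w) \<Longrightarrow> {0, Suc (length w)} \<in> last_edges x w \<longleftrightarrow> x = Spoke"
  by (cases x) (auto simp: last_edges_def doubleton_eq_iff)

lemma last_edges_Free_iff: "last_edges x w = {} \<longleftrightarrow> x = Free"
  by (cases x) (auto simp: last_edges_def)

lemma last_spoke_iff:
  assumes "admissible w" "w \<noteq> []"
  shows "{0, length w} \<in> word_edges w \<longleftrightarrow> hd w = Spoke"
proof (cases w)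
  case (Cons x v)
  have "{0, Suc (length v)} \<notin> word_edges v"
    using word_edges_bound[of "{0, Suc (length v)}" v] by auto
  then show ?thesis
    using assms Cons last_edges_Spoke_iff[of x v] by simp
qed (use assms in simp)

lemma word_edges_inject:
  assumes "admissible w" "admissible v" "length w = length v" "word_edges w = word_edges v"
  shows "w = v"
  using assms
proof (induction w arbitrary: v)
  case (Cons x w)
  obtain y u where v: "v = y # u" "length u = length w"
    using Cons.prems(3) by (cases v) auto
  have "last_edges x w \<inter> word_edges w = {}" "last_edges x w \<inter> word_edges u = {}"
    "last_edges y u \<inter> word_edges w = {}" "last_edges y u \<inter> word_edges u = {}"
    using last_edges_not_earlier[of w w] last_edges_not_earlier[of u w] last_edges_not_earlier[of w u]
      last_edges_not_earlier[of u u] v(2) by auto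
  moreover have "word_edges w \<union> last_edges x w = word_edges u \<union> last_edges y u"
    using Cons.prems(4) v by simp
  ultimately have new: "last_edges x w = last_edges y u" and old: "word_edges w = word_edges u"
    by blast+
  have "w = u"
    using Cons.IH[of u] Cons.prems v old by simp
  moreover have "x = Spoke \<longleftrightarrow> y = Spoke"
    using new last_edges_Spoke_iff[OF Cons.prems(1)] last_edges_Spoke_iff[of y u] Cons.prems(2) v by simp
  moreover have "x = Free \<longleftrightarrow> y = Free"
    using new last_edges_Free_iff[of x w] last_edges_Free_iff[of y u] by simp
  ultimately have "x = y"
    by (metis letter.exhaust)
  with \<open>w = u\<close> show ?case by (simp add: v)
qed simp

section \<open>Colourings of fans, vertex by vertex\<close>

text \<open>
  The number of colours for a new vertex, once the earlier ones are coloured. A letter other than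
  \<open>Free\<close> in the smaller flat forces the colour of the hub or of the neighbour. Otherwise the colours
  of hub and neighbour are excluded as far as the larger flat joins the vertex to them; these are
  two different colours exactly if the larger flat has the spoke of the neighbour and the smaller
  flat does not.
\<close>

definition local_colours :: "letter \<Rightarrow> letter list \<Rightarrow> letter \<Rightarrow> letter list \<Rightarrow> int poly" where
  "local_colours x w y v =
     (if y \<noteq> Free then 1
      else case x of
        Spoke \<Rightarrow> if spoke_top w \<and> hd v \<noteq> Spoke then [:-2, 1:] else [:-1, 1:]
      | Rim \<Rightarrow> [:-1, 1:]
      | Free \<Rightarrow> [:0, 1:])"

text \<open>
  The value at empty words is the number of colours of the hub.
\<close>

fun word_chromatic :: "letter list \<Rightarrow> letter list \<Rightarrow> int poly" where
  "word_chromatic (x # w) (y # v) = local_colours x w y v * word_chromatic w v"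
| "word_chromatic _ _ = [:0, 1:]"

lemma colorings_extend:
  assumes old: "\<And>e. e \<in> A \<union> B \<Longrightarrow> e \<subseteq> {0..n}"
    and new: "\<And>e. e \<in> A' \<union> B' \<Longrightarrow> \<exists>i\<le>n. e = {i, Suc n}"
  shows "card (colorings {0..Suc n} id (A \<union> A') (B \<union> B') k) =
    (\<Sum>f\<in>colorings {0..n} id A B k.
       card {c \<in> {..<k}. (\<forall>i\<le>n. {i, Suc n} \<in> A' \<longrightarrow> f i = c) \<and> (\<forall>i\<le>n. {i, Suc n} \<in> B' \<longrightarrow> f i \<noteq> c)})"
proof -
  define L where "L f = {c \<in> {..<k}. (\<forall>i\<le>n. {i, Suc n} \<in> A' \<longrightarrow> f i = c) \<and>
    (\<forall>i\<le>n. {i, Suc n} \<in> B' \<longrightarrow> f i \<noteq> c)}" for f :: "nat \<Rightarrow> nat"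
  have "bij_betw (\<lambda>(f, c). f(Suc n := c)) (SIGMA f:colorings {0..n} id A B k. L f)
      (colorings {0..Suc n} id (A \<union> A') (B \<union> B') k)"
  proof (rule bij_betw_byWitness[where f' = "\<lambda>g. (restrict g {0..n}, g (Suc n))"])
    show "\<forall>x\<in>SIGMA f:colorings {0..n} id A B k. L f.
        (restrict (case x of (f, c) \<Rightarrow> f(Suc n := c)) {0..n}, (case x of (f, c) \<Rightarrow> f(Suc n := c)) (Suc n)) = x"
      by (auto simp: colorings_def fun_eq_iff PiE_def extensional_def)
    show "\<forall>g\<in>colorings {0..Suc n} id (A \<union> A') (B \<union> B') k.
        (case (restrict g {0..n}, g (Suc n)) of (f, c) \<Rightarrow> f(Suc n := c)) = g"
      by (auto simp: colorings_def fun_eq_iff PiE_def extensional_def)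
    show "(\<lambda>g. (restrict g {0..n}, g (Suc n))) ` colorings {0..Suc n} id (A \<union> A') (B \<union> B') k
        \<subseteq> (SIGMA f:colorings {0..n} id A B k. L f)"
    proof (clarify, intro conjI)
      fix g assume g: "g \<in> colorings {0..Suc n} id (A \<union> A') (B \<union> B') k"
      have gA: "g u = g v" if "e \<in> A \<union> A'" "id e = {u, v}" for e u v
        using g that unfolding colorings_def by blast
      have gB: "g u \<noteq> g v" if "e \<in> B \<union> B'" "id e = {u, v}" for e u v
        using g that unfolding colorings_def by blast
      have gr: "restrict g {0..n} u = g u" "restrict g {0..n} v = g v" if "e \<in> A \<union> B" "id e = {u, v}" for e u v
        using old[OF that(1)] that(2) by auto
      have "restrict g {0..n} u = restrict g {0..n} v" if "e \<in> A" "id e = {u, v}" for e u v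
        using gr[of e u v] gA[of e u v] that by simp
      moreover have "restrict g {0..n} u \<noteq> restrict g {0..n} v" if "e \<in> B" "id e = {u, v}" for e u v
        using gr[of e u v] gB[of e u v] that by simp
      moreover have "restrict g {0..n} \<in> {0..n} \<rightarrow>\<^sub>E {..<k}"
        using g by (auto simp: colorings_def)
      ultimately show "restrict g {0..n} \<in> colorings {0..n} id A B k"
        unfolding colorings_def by blast
      show "g (Suc n) \<in> L (restrict g {0..n})"
        unfolding L_def
      proof (intro CollectI conjI allI impI)
        show "g (Suc n) \<in> {..<k}" using g by (auto simp: colorings_def)
        fix i assume "i \<le> n"
        then show "{i, Suc n} \<in> A' \<Longrightarrow> restrict g {0..n} i = g (Suc n)"
          and "{i, Suc n} \<in> B' \<Longrightarrow> restrict g {0..n} i \<noteq> g (Suc n)"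
          using gA[of "{i, Suc n}" i "Suc n"] gB[of "{i, Suc n}" i "Suc n"] by simp_all
      qed
    qed
    show "(\<lambda>(f, c). f(Suc n := c)) ` (SIGMA f:colorings {0..n} id A B k. L f)
        \<subseteq> colorings {0..Suc n} id (A \<union> A') (B \<union> B') k"
    proof clarify
      fix f c assume f: "f \<in> colorings {0..n} id A B k" and c: "c \<in> L f"
      let ?g = "f(Suc n := c)"
      have gf: "?g u = f u" "?g v = f v" if "e \<in> A \<union> B" "e = {u, v}" for e u v
        using old[OF that(1)] that(2) by auto
      have "?g u = ?g v" if uv: "e \<in> A \<union> A'" "id e = {u, v}" for e u v
      proof (cases "e \<in> A")
        case True
        then show ?thesis using gf[of e u v] f uv by (simp add: colorings_def)
      next
        case False
        then obtain i where "i \<le> n" "{i, Suc n} \<in> A'" "{u, v} = {i, Suc n}"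
          using uv new[of e] by auto
        then show ?thesis using c by (auto simp: L_def doubleton_eq_iff)
      qed
      moreover have "?g u \<noteq> ?g v" if uv: "e \<in> B \<union> B'" "id e = {u, v}" for e u v
      proof (cases "e \<in> B")
        case True
        then show ?thesis using gf[of e u v] f uv by (simp add: colorings_def)
      next
        case False
        then obtain i where "i \<le> n" "{i, Suc n} \<in> B'" "{u, v} = {i, Suc n}"
          using uv new[of e] by auto
        then show ?thesis using c by (auto simp: L_def doubleton_eq_iff)
      qed
      moreover have "?g \<in> {0..Suc n} \<rightarrow>\<^sub>E {..<k}"
        using f c by (auto simp: colorings_def L_def PiE_def extensional_def Pi_def)
      ultimately show "?g \<in> colorings {0..Suc n} id (A \<union> A') (B \<union> B') k"
        unfolding colorings_def by blast
    qed
  qed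
  then have "card (colorings {0..Suc n} id (A \<union> A') (B \<union> B') k) =
      card (SIGMA f:colorings {0..n} id A B k. L f)"
    by (rule bij_betw_same_card[symmetric])
  also have "\<dots> = (\<Sum>f\<in>colorings {0..n} id A B k. card (L f))"
    by (rule card_SigmaI) (auto simp: L_def)
  finally show ?thesis by (simp add: L_def)
qed

text \<open>
  The number of admissible colours for the last vertex depends on the letters only, not on the
  colouring of the earlier vertices.
\<close>

lemma card_colorings_word:
  assumes "admissible w" "v \<in> subwords w"
  shows "int (card (colorings {0..length w} id (word_edges v) (word_edges w - word_edges v) k)) =
    poly (word_chromatic w v) (int k)"
  using assms
proof (induction w arbitrary: v)
  case Nil
  then show ?case by (simp add: colorings_def card_PiE)
next
  case (Cons x w)
  obtain y u where v: "v = y # u" by (rule subword_not_Nil[OF Cons.prems(2)])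
  note sub = subword_Cons[OF Cons.prems(2)[unfolded v]]
  define n where "n = length w"
  have len: "length w = n" "length u = n"
    using length_subword[OF sub(1)] by (simp_all add: n_def)
  have adm: "admissible w" "admissible u"
    using Cons.prems(1) admissible_subword[OF _ sub(1)] by simp_all
  let ?A' = "last_edges y u" and ?B' = "last_edges x w - last_edges y u"
  let ?C = "colorings {0..n} id (word_edges u) (word_edges w - word_edges u) k"
  let ?L = "\<lambda>f. {c \<in> {..<k}. (\<forall>i\<le>n. {i, Suc n} \<in> ?A' \<longrightarrow> f i = c) \<and> (\<forall>i\<le>n. {i, Suc n} \<in> ?B' \<longrightarrow> f i \<noteq> c)}"
  have "word_edges (x # w) - word_edges (y # u) = (word_edges w - word_edges u) \<union> ?B'"
    using last_edges_not_earlier[of w u _ y] last_edges_not_earlier[of u w _ x] len by auto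
  moreover have "card (colorings {0..Suc n} id (word_edges u \<union> ?A') ((word_edges w - word_edges u) \<union> ?B') k)
      = (\<Sum>f\<in>?C. card (?L f))"
    by (rule colorings_extend)
       (use word_edges_bound[of _ u] word_edges_bound[of _ w] last_edges_subset[of _ y u] last_edges_subset[of _ x w] len in auto)
  ultimately have "int (card (colorings {0..length (x # w)} id (word_edges v) (word_edges (x # w) - word_edges v) k))
      = (\<Sum>f\<in>?C. int (card (?L f)))"
    by (simp add: v len)
  also have "\<dots> = (\<Sum>f\<in>?C. poly (local_colours x w y u) (int k))"
  proof (rule sum.cong[OF refl])
    fix f assume f: "f \<in> ?C"
    have bound: "f 0 < k" "f n < k" using f by (auto simp: colorings_def)
    \<comment> \<open>If the previous vertex is a spoke, the spoke edge fixes how its colour relates to the hub.\<close>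
    have eq: "f 0 = f n" if "u \<noteq> []" "hd u = Spoke"
      using f last_spoke_iff[OF adm(2)] that len by (auto simp: colorings_def)
    have neq: "f 0 \<noteq> f n" if "w \<noteq> []" "hd w = Spoke" "hd u \<noteq> Spoke"
    proof -
      have "u \<noteq> []" using that(1) len by auto
      then have "{0, n} \<in> word_edges w - word_edges u"
        using last_spoke_iff[OF adm(1)] last_spoke_iff[OF adm(2)] that len by auto
      then show ?thesis using f by (auto simp: colorings_def)
    qed
    have nil: "u = [] \<longleftrightarrow> w = []" using len by auto
    consider (spoke) "x = Spoke" "y = Spoke" | (rim) "x = Rim" "y = Rim"
      | (spoke_rim) "x = Spoke" "y = Rim" "spoke_top w" "hd u \<noteq> Spoke"
      | (free) "x = Free" "y = Free" | (rim_free) "x = Rim" "y = Free"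
      | (spoke_free) "x = Spoke" "y = Free" "\<not> spoke_top w \<or> hd u = Spoke"
      | (spoke_free_free) "x = Spoke" "y = Free" "spoke_top w" "hd u \<noteq> Spoke"
      using sub(2,3) by (cases x; cases y) auto
    then show "int (card (?L f)) = poly (local_colours x w y u) (int k)"
    proof cases
      case spoke
      then have "?L f = {f 0}"
        using bound eq neq hd_subword[OF sub(1)] nil len
        by (auto simp: last_edges_def doubleton_eq_iff split: if_splits)
      then show ?thesis using spoke by (simp add: local_colours_def)
    next
      case rim
      then have "?L f = {f n}"
        using bound len by (auto simp: last_edges_def doubleton_eq_iff)
      then show ?thesis using rim by (simp add: local_colours_def)
    next
      case spoke_rim
      then have "?L f = {f n}"
        using bound neq len by (auto simp: last_edges_def doubleton_eq_iff)
      then show ?thesis using spoke_rim by (simp add: local_colours_def)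
    next
      case free
      then have "?L f = {..<k}"
        by (auto simp: last_edges_def)
      then show ?thesis using free by (simp add: local_colours_def)
    next
      case rim_free
      then have "?L f = {..<k} - {f n}"
        using len by (auto simp: last_edges_def doubleton_eq_iff)
      then show ?thesis using rim_free bound by (simp add: local_colours_def of_nat_diff)
    next
      case spoke_free
      then have "?L f = {..<k} - {f 0}"
        using len eq nil by (auto simp: last_edges_def doubleton_eq_iff split: if_splits)
      then show ?thesis using spoke_free bound by (auto simp: local_colours_def of_nat_diff)
    next
      case spoke_free_free
      then have "?L f = {..<k} - {f 0, f n}"
        using len by (auto simp: last_edges_def doubleton_eq_iff split: if_splits)
      moreover have "card ({..<k} - {f 0, f n}) = k - 2"
        using bound neq spoke_free_free by (subst card_Diff_subset) auto
      moreover have "k \<ge> 2"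
        using bound neq spoke_free_free by (metis One_nat_def less_2_cases_iff less_one not_less_eq_eq not_le)
      ultimately show ?thesis using spoke_free_free by (simp add: local_colours_def of_nat_diff)
    qed
  qed
  also have "\<dots> = int (card ?C) * poly (local_colours x w y u) (int k)"
    by (simp only: sum_constant)
  also have "int (card ?C) = poly (word_chromatic w u) (int k)"
    using Cons.IH[OF adm(1) sub(1)] by (simp only: len)
  finally show ?case
    by (simp only: v word_chromatic.simps poly_mult mult.commute)
qed

text \<open>
  Three colours are always enough, since a new vertex avoids at most two colours. Together with
  \<open>card_colorings_word\<close> this provides a colouring that certifies a subword as a flat.
\<close>

lemma word_chromatic_3_pos: "poly (word_chromatic w v) 3 > 0"
  by (induction w v rule: word_chromatic.induct) (auto simp: local_colours_def split: letter.splits)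

definition word_graph :: "letter list \<Rightarrow> (nat, nat set) mgraph" where
  "word_graph w = \<lparr>verts = (\<Union>e\<in>word_edges w. id e), edges = word_edges w, ends = id\<rparr>"

lemma graph_word_graph: "graph (word_graph w)"
  using word_edges_bound[of _ w] finite_word_edges[of w]
  by (auto simp: graph_def word_graph_def intro: finite_subset[of _ "{0..length w}"])

lemma edge_sub_word_graph: "edge_sub (word_graph w) (word_edges v) = word_graph v"
  by (simp add: edge_sub_def word_graph_def)

text \<open>
  The word of a colouring is read off vertex by vertex: a spoke if the colour agrees with the hub,
  else a rim edge if it agrees with the neighbour. Conversely, every subword is certified by a
  colouring with three colours.
\<close>

lemma flats_word_graph:
  assumes "admissible w"
  shows "flats (word_graph w) = word_edges ` subwords w"
proof -
  define mono_edges where "mono_edges E f = {e \<in> E. \<forall>p q. e = {p, q} \<longrightarrow> f p = f q}"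
    for E :: "nat set set" and f :: "nat \<Rightarrow> nat"
  have flats: "flats (word_graph w) = range (mono_edges (word_edges w))"
    by (auto simp: flats_def word_graph_def mono_edges_def)
  have "\<exists>v\<in>subwords w. mono_edges (word_edges w) f = word_edges v" for f
    using assms
  proof (induction w)
    case Nil
    then show ?case by (simp add: mono_edges_def)
  next
    case (Cons x w)
    then obtain u where u: "u \<in> subwords w" "mono_edges (word_edges w) f = word_edges u"
      by auto
    define n where "n = length w"
    have len: "length w = n" "length u = n"
      using length_subword[OF u(1)] by (simp_all add: n_def)
    have adm: "admissible w" "admissible u"
      using Cons.prems(1) admissible_subword[OF _ u(1)] by simp_all
    have step: "mono_edges (word_edges (x # w)) f = word_edges u \<union> mono_edges (last_edges x w) f"
      unfolding u(2)[symmetric] by (auto simp: mono_edges_def)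
    have top: "hd u = Spoke \<longleftrightarrow> f 0 = f n" if "spoke_top w"
    proof -
      have "u \<noteq> []" using that len by auto
      then have "hd u = Spoke \<longleftrightarrow> {0, n} \<in> mono_edges (word_edges w) f"
        using last_spoke_iff[OF adm(2)] len u(2) by simp
      also have "\<dots> \<longleftrightarrow> f 0 = f n"
        using last_spoke_iff[OF adm(1)] that len by (auto simp: mono_edges_def doubleton_eq_iff)
      finally show ?thesis .
    qed
    have "mono_edges (insert e E) f =
        (if \<forall>p q. e = {p, q} \<longrightarrow> f p = f q then insert e (mono_edges E f) else mono_edges E f)" for e E
      by (auto simp: mono_edges_def)
    moreover have "(\<forall>a b. {p, q} = {a, b} \<longrightarrow> f a = f b) \<longleftrightarrow> f p = f q" for p q
      by (auto simp: doubleton_eq_iff)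
    ultimately have ins: "mono_edges (insert {p, q} E) f =
        (if f p = f q then insert {p, q} (mono_edges E f) else mono_edges E f)" for p q E
      by simp
    have emp: "mono_edges {} f = {}"
      by (simp add: mono_edges_def)
    have nil: "u = [] \<longleftrightarrow> w = []" using len by auto
    define y where "y = (case x of
        Spoke \<Rightarrow> if f 0 = f (Suc n) then Spoke else if spoke_top w \<and> f n = f (Suc n) then Rim else Free
      | Rim \<Rightarrow> if f n = f (Suc n) then Rim else Free
      | Free \<Rightarrow> Free)"
    have "mono_edges (last_edges x w) f = last_edges y u"
    proof (cases x)
      case Spoke
      show ?thesis
      proof (cases "spoke_top w")
        case True
        then have "u \<noteq> []" "hd u = Spoke \<longleftrightarrow> f 0 = f n" using nil top by auto
        then show ?thesis
          using True by (cases "f 0 = f (Suc n)") (auto simp: Spoke last_edges_def len ins emp y_def)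
      next
        case False
        then have "\<not> spoke_top u" using hd_subword[OF u(1)] by blast
        with False show ?thesis
          by (cases "f 0 = f (Suc n)") (auto simp: Spoke last_edges_def len ins emp y_def)
      qed
    qed (simp_all add: last_edges_def len ins emp y_def)
    moreover have "y # u \<in> subwords (x # w)"
      using u(1) top by (auto simp: y_def split: letter.splits)
    ultimately show ?case
      using step by (intro bexI[of _ "y # u"]) simp_all
  qed
  moreover have "word_edges v \<in> range (mono_edges (word_edges w))" if v: "v \<in> subwords w" for v
  proof -
    have "card (colorings {0..length w} id (word_edges v) (word_edges w - word_edges v) 3) > 0"
      using card_colorings_word[OF assms v, of 3] word_chromatic_3_pos[of w v] by simp
    then obtain f where f: "f \<in> colorings {0..length w} id (word_edges v) (word_edges w - word_edges v) 3"
      by (metis card_gt_0_iff ex_in_conv)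
    have "mono_edges (word_edges w) f = word_edges v"
    proof (intro subset_antisym subsetI)
      fix e assume e: "e \<in> mono_edges (word_edges w) f"
      then have "card e = 2" using word_edges_bound[of e w] by (simp add: mono_edges_def)
      then obtain p q where pq: "e = {p, q}" by (auto simp: card_2_iff)
      then have "f p = f q" "e \<in> word_edges w" using e by (simp_all add: mono_edges_def)
      moreover have "f p \<noteq> f q" if "e \<in> word_edges w - word_edges v" "id e = {p, q}"
        using f that unfolding colorings_def by blast
      ultimately show "e \<in> word_edges v" using pq by auto
    next
      fix e assume "e \<in> word_edges v"
      then show "e \<in> mono_edges (word_edges w) f"
        using f subword_edges[OF v] by (auto simp: colorings_def mono_edges_def)
    qed
    then show ?thesis by blast
  qed
  ultimately show ?thesis unfolding flats by blast
qed

definition word_rank :: "letter list \<Rightarrow> nat" where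
  "word_rank w = length (filter (\<lambda>x. x \<noteq> Free) w)"

text \<open>
  The factor of one vertex in \<open>(-1)\<^bsup>rank\<^esup> t\<^bsup>corank\<^esup> \<chi>(1/t)\<close>: a sign for a letter that adds to the rank,
  and \<open>t\<close> times the number of colours at \<open>1/t\<close> for a free vertex.
\<close>

definition local_weight :: "letter \<Rightarrow> letter list \<Rightarrow> letter \<Rightarrow> letter list \<Rightarrow> int poly fract" where
  "local_weight x w y v =
     (if y \<noteq> Free then - 1
      else case x of
        Spoke \<Rightarrow> if spoke_top w \<and> hd v \<noteq> Spoke then 1 - 2 * tt else 1 - tt
      | Rim \<Rightarrow> 1 - tt
      | Free \<Rightarrow> 1)"

fun word_weight :: "letter list \<Rightarrow> letter list \<Rightarrow> int poly fract" where
  "word_weight (x # w) (y # v) = local_weight x w y v * word_weight w v"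
| "word_weight _ _ = 1"

text \<open>
  The number of components of the flat on all vertices: each component other than that of the hub
  has a unique free vertex, namely its first one.
\<close>

definition word_corank :: "letter list \<Rightarrow> nat" where
  "word_corank w = Suc (length (filter (\<lambda>x. x = Free) w))"

lemma word_rank_corank: "word_rank w + word_corank w = Suc (length w)"
  unfolding word_rank_def word_corank_def
  using sum_length_filter_compl[of "\<lambda>x. x = Free" w] by simp

lemma word_chromatic_self: "word_chromatic w w = [:0, 1:] ^ word_corank w"
  by (induction w) (auto simp: word_corank_def local_colours_def)

lemma word_weight_eq:
  assumes "length w = length v"
  shows "(- 1) ^ word_rank v * (tt ^ word_corank v * eval_at (word_chromatic w v) (inverse tt)) = word_weight w v"
  using assms
proof (induction w v rule: list_induct2)
  case Nil
  show ?case by (simp add: word_rank_def word_corank_def)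
next
  case (Cons x w y v)
  have free: "tt * eval_at (local_colours x w Free v) (inverse tt) = local_weight x w Free v"
    by (cases x) (simp_all add: local_colours_def local_weight_def algebra_simps)
  show ?case
  proof (cases "y = Free")
    case True
    then have "(- 1) ^ word_rank (y # v) *
        (tt ^ word_corank (y # v) * eval_at (word_chromatic (x # w) (y # v)) (inverse tt)) =
      (tt * eval_at (local_colours x w Free v) (inverse tt)) *
        ((- 1) ^ word_rank v * (tt ^ word_corank v * eval_at (word_chromatic w v) (inverse tt)))"
      by (simp add: word_rank_def word_corank_def eval_at_mult)
    then show ?thesis
      by (simp only: free Cons.IH True word_weight.simps)
  next
    case False
    then show ?thesis
      unfolding word_weight.simps Cons.IH[symmetric]
      by (simp add: word_rank_def word_corank_def local_colours_def local_weight_def)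
  qed
qed

lemma span_word_graph:
  "graph ((word_graph w)\<lparr>verts := {0..length w}\<rparr>)" "verts (word_graph w) \<subseteq> {0..length w}"
  using word_edges_bound[of _ w] finite_word_edges[of w]
  by (auto simp: graph_def word_graph_def)

lemma card_components_word:
  assumes "admissible v" "length v = n"
  shows "card (components \<lparr>verts = {0..n}, edges = word_edges v, ends = id\<rparr>) = word_corank v"
proof -
  let ?G = "\<lparr>verts = {0..n}, edges = word_edges v, ends = id\<rparr> :: (nat, nat set) mgraph"
  have "graph ?G" using span_word_graph[of v] assms by (simp add: word_graph_def)
  from card_colorings_components[OF this, of 2]
  have "int (2 ^ card (components ?G)) = poly (word_chromatic v v) (int 2)"
    using card_colorings_word[OF assms(1) self_subword, of 2] assms by simp
  also have "\<dots> = int (2 ^ word_corank v)"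
    by (simp add: word_chromatic_self assms)
  finally have "(2::nat) ^ card (components ?G) = 2 ^ word_corank v"
    by (simp only: of_nat_eq_iff)
  then show ?thesis by (simp only: power_inject_exp)
qed

text \<open>
  The rank ignores isolated vertices, so it can be computed in the spanning subgraph.
\<close>

lemma rk_word_graph:
  assumes "admissible w"
  shows "rk (word_graph w) = word_rank w"
proof -
  let ?G = "(word_graph w)\<lparr>verts := {0..length w}\<rparr>"
  have "rk (edge_sub ?G (word_edges w)) + card (components (?G\<lparr>edges := word_edges w\<rparr>)) = card (verts ?G)"
    by (rule rk_edge_sub[OF span_word_graph(1)]) (simp add: word_graph_def)
  moreover have "edge_sub ?G (word_edges w) = word_graph w"
    by (simp add: edge_sub_def word_graph_def)
  ultimately show ?thesis
    using card_components_word[OF assms refl] word_rank_corank[of w] by (simp add: word_graph_def)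
qed

lemma contraction_weight_word:
  assumes "admissible w" "v \<in> subwords w"
  shows "(- 1) ^ word_rank v * contraction_weight (word_graph w) (word_edges v) = word_weight w v"
proof -
  let ?G = "(word_graph w)\<lparr>verts := {0..length w}\<rparr>"
  have sub: "word_edges v \<subseteq> edges (word_graph w)"
    using subword_edges[OF assms(2)] by (simp add: word_graph_def)
  note len = length_subword[OF assms(2)]
  have "chromatic_poly (contract ?G (word_edges v)) = word_chromatic w v"
  proof (rule poly_eq_if_eq_on_nats)
    fix k
    show "poly (chromatic_poly (contract ?G (word_edges v))) (int k) = poly (word_chromatic w v) (int k)"
      using chromatic_poly_contract[OF span_word_graph(1), of "word_edges v" w k] sub
        card_colorings_word[OF assms, of k] by (simp add: word_graph_def)
  qed
  moreover have "card (components (?G\<lparr>edges := word_edges v\<rparr>)) = word_corank v"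
    using card_components_word[OF admissible_subword[OF assms] refl] len by (simp add: word_graph_def)
  ultimately have "contraction_weight ?G (word_edges v) =
      tt ^ word_corank v * eval_at (word_chromatic w v) (inverse tt)"
    by (simp add: contraction_weight_def)
  then show ?thesis
    using contraction_weight_isolated[OF graph_word_graph _ span_word_graph(2) sub] word_weight_eq[of w v] len
    by simp
qed

section \<open>The generating function of the fan polynomials\<close>

text \<open>
  The coefficients of the series \<open>v\<close> with \<open>v = u (1 + t v\<^sup>2)\<close>. They are defined by the recursion that
  this equation amounts to, so that they are integer polynomials by construction.
\<close>

fun catalan_poly :: "nat \<Rightarrow> int poly" where
  "catalan_poly 0 = 0"
| "catalan_poly (Suc n) = (if n = 0 then 1 else 0) + [:0, 1:] * (\<Sum>i\<le>n. catalan_poly i * catalan_poly (n - i))"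

text \<open>
  The coefficients of \<open>(1 - v) / (1 - 2 v)\<close>, from the recursion \<open>\<Psi> = 1 - v + 2 \<Psi> v\<close>.
\<close>

fun fan_poly :: "nat \<Rightarrow> int poly" where
  "fan_poly n = (if n = 0 then 1 else 0) - catalan_poly n + 2 * (\<Sum>i<n. fan_poly i * catalan_poly (n - i))"

declare catalan_poly.simps(2) [simp del] fan_poly.simps [simp del]

text \<open>
  The pairs \<open>(degree, index)\<close> below the line \<open>2 d = n - 1\<close> are preserved by \<open>u t v\<^sup>2\<close>. The constant
  coefficient is exceptional, as the truncated \<open>0 - 1\<close> is \<open>0\<close>; it vanishes, and products with it
  have to be discarded.
\<close>

lemma degree_catalan_poly: "2 * degree (catalan_poly n) \<le> n - 1"
proof (induction n rule: less_induct)
  case (less n)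
  show ?case
  proof (cases n)
    case 0 then show ?thesis by simp
  next
    case (Suc m)
    have *: "degree ([:0, 1:] * (catalan_poly i * catalan_poly (m - i))) \<le> m div 2" if "i \<le> m" for i
    proof (cases "catalan_poly i = 0 \<or> catalan_poly (m - i) = 0")
      case False
      then have "i \<noteq> 0" "m - i \<noteq> 0" by (metis catalan_poly.simps(1))+
      then have "2 * degree (catalan_poly i) \<le> i - 1" "2 * degree (catalan_poly (m - i)) \<le> m - i - 1"
        using less[of i] less[of "m - i"] that Suc by auto
      with \<open>i \<noteq> 0\<close> \<open>m - i \<noteq> 0\<close> have "2 * (1 + degree (catalan_poly i) + degree (catalan_poly (m - i))) \<le> m"
        using that by (simp add: mult_2)
      then show ?thesis using False
        by (subst degree_mult_eq) (auto simp: degree_mult_eq)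
    qed auto
    have "degree (\<Sum>i\<le>m. [:0, 1:] * (catalan_poly i * catalan_poly (m - i))) \<le> m div 2"
      by (intro degree_sum_le) (use * in auto)
    then have "degree (catalan_poly n) \<le> m div 2"
      unfolding Suc catalan_poly.simps sum_distrib_left by (intro degree_add_le) auto
    then show ?thesis using Suc by simp
  qed
qed

lemma degree_fan_poly: "2 * degree (fan_poly n) \<le> n - 1"
proof (induction n rule: less_induct)
  case (less n)
  have v: "degree (catalan_poly k) \<le> (k - 1) div 2" for k
    using degree_catalan_poly[of k] by linarith
  have *: "degree (fan_poly i * catalan_poly (n - i)) \<le> (n - 1) div 2" if "i < n" for i
  proof -
    have "degree (fan_poly i * catalan_poly (n - i)) \<le> degree (fan_poly i) + degree (catalan_poly (n - i))"
      by (rule degree_mult_le)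
    then show ?thesis using less[OF that] degree_catalan_poly[of "n - i"] that by linarith
  qed
  have "degree (2 * (\<Sum>i<n. fan_poly i * catalan_poly (n - i))) \<le> (n - 1) div 2"
    unfolding mult_2 by (intro degree_add_le degree_sum_le) (use * in auto)
  then have "degree (fan_poly n) \<le> (n - 1) div 2"
    using v[of n] by (subst fan_poly.simps) (intro degree_add_le degree_diff_le, auto)
  then show ?case by linarith
qed

lemma fan_poly_0 [simp]: "fan_poly 0 = 1"
  by (subst fan_poly.simps) simp

text \<open>
  The substitution \<open>t := x, u := y u\<close>, a ring homomorphism.
\<close>

definition specialize :: "int poly fract \<Rightarrow> int poly fract \<Rightarrow> int poly fps \<Rightarrow> int poly fract fps" where
  "specialize x y A = Abs_fps (\<lambda>n. y ^ n * eval_at (A $ n) x)"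

lemma specialize_add: "specialize x y (A + B) = specialize x y A + specialize x y B"
  by (simp add: specialize_def fps_eq_iff eval_at_add algebra_simps)

lemma specialize_diff: "specialize x y (A - B) = specialize x y A - specialize x y B"
  by (simp add: specialize_def fps_eq_iff eval_at_diff algebra_simps)

lemma specialize_1: "specialize x y 1 = 1"
  by (simp add: specialize_def fps_eq_iff)

lemma specialize_mult: "specialize x y (A * B) = specialize x y A * specialize x y B"
proof (rule fps_ext)
  fix n
  have "y ^ n = y ^ i * y ^ (n - i)" if "i \<le> n" for i
    using that by (simp flip: power_add)
  then show "specialize x y (A * B) $ n = (specialize x y A * specialize x y B) $ n"
    by (simp add: specialize_def fps_mult_nth eval_at_sum eval_at_mult sum_distrib_left ac_simps)
qed

lemma specialize_X: "specialize x y fps_X = fps_const y * fps_X"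
  by (auto simp: specialize_def fps_eq_iff fps_X_def)

lemma specialize_const: "specialize x y (fps_const p) = fps_const (eval_at p x)"
  by (auto simp: specialize_def fps_eq_iff)

definition catalan_fps :: "int poly fps" where
  "catalan_fps = Abs_fps catalan_poly"

definition fan_fps :: "int poly fps" where
  "fan_fps = Abs_fps fan_poly"

lemma catalan_fps_eq: "catalan_fps = fps_X * (1 + fps_const [:0, 1:] * (catalan_fps * catalan_fps))"
proof (rule fps_ext)
  fix n
  show "catalan_fps $ n = (fps_X * (1 + fps_const [:0, 1:] * (catalan_fps * catalan_fps))) $ n"
  proof (cases n)
    case (Suc m)
    have "(fps_X * (1 + fps_const [:0, 1:] * (catalan_fps * catalan_fps))) $ n = (1 + fps_const [:0, 1:] * (catalan_fps * catalan_fps)) $ m"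
      by (simp only: fps_X_mult_nth Suc) simp
    also have "\<dots> = (if m = 0 then 1 else 0) + [:0, 1:] * (catalan_fps * catalan_fps) $ m"
      by (simp only: fps_add_nth fps_one_nth fps_mult_left_const_nth)
    also have "(catalan_fps * catalan_fps) $ m = (\<Sum>i\<le>m. catalan_poly i * catalan_poly (m - i))"
      by (simp add: catalan_fps_def fps_mult_nth atLeast0AtMost)
    finally show ?thesis
      by (simp add: catalan_fps_def Suc catalan_poly.simps(2))
  qed (simp add: catalan_fps_def)
qed

lemma fan_fps_eq: "fan_fps * (1 - 2 * catalan_fps) = 1 - catalan_fps"
proof -
  have "fan_fps = 1 - catalan_fps + 2 * (fan_fps * catalan_fps)"
  proof (rule fps_ext)
    fix n
    have "(2 * (fan_fps * catalan_fps)) $ n = 2 * (fan_fps * catalan_fps) $ n"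
      by (metis fps_mult_left_const_nth numeral_fps_const)
    moreover have "(fan_fps * catalan_fps) $ n = (\<Sum>i<n. fan_poly i * catalan_poly (n - i))"
      by (simp add: fan_fps_def catalan_fps_def fps_mult_nth atLeast0AtMost lessThan_Suc_atMost[symmetric])
    ultimately show "fan_fps $ n = (1 - catalan_fps + 2 * (fan_fps * catalan_fps)) $ n"
      by (simp add: fan_fps_def catalan_fps_def fan_poly.simps[of n])
  qed
  then show ?thesis by (simp add: algebra_simps)
qed

text \<open>
  The difference of two solutions is a multiple of \<open>u\<close> times itself.
\<close>

lemma quadratic_fps_unique:
  fixes y z :: "'a::idom fps"
  assumes "y = fps_const a * fps_X * (1 + fps_const b * (y * y))"
    and "z = fps_const a * fps_X * (1 + fps_const b * (z * z))"
  shows "y = z"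
proof -
  let ?c = "fps_const a * fps_X * fps_const b * (y + z)"
  have "y - z = fps_const a * fps_X * (1 + fps_const b * (y * y)) - fps_const a * fps_X * (1 + fps_const b * (z * z))"
    using assms by simp
  also have "\<dots> = ?c * (y - z)"
    by (simp add: algebra_simps)
  finally have "(y - z) * (1 - ?c) = 0"
    by (simp add: algebra_simps)
  moreover have "(1 - ?c) $ 0 = 1"
    by (simp add: mult.assoc)
  then have "1 - ?c \<noteq> 0" by force
  ultimately show ?thesis by simp
qed

lemma specialize_catalan_fps:
  "specialize x y catalan_fps =
     fps_const y * fps_X * (1 + fps_const x * (specialize x y catalan_fps * specialize x y catalan_fps))"
proof -
  have "specialize x y catalan_fps = specialize x y (fps_X * (1 + fps_const [:0, 1:] * (catalan_fps * catalan_fps)))"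
    using catalan_fps_eq by (rule arg_cong)
  then show ?thesis
    by (simp only: specialize_mult specialize_add specialize_1 specialize_X specialize_const) simp
qed

lemma specialize_catalan_fps_nth_0 [simp]: "specialize x y catalan_fps $ 0 = 0"
  by (simp add: specialize_def catalan_fps_def)

lemma specialize_fan_fps:
  "specialize x y fan_fps * (1 - 2 * specialize x y catalan_fps) = 1 - specialize x y catalan_fps"
proof -
  have "specialize x y (fan_fps * (1 - 2 * catalan_fps)) = specialize x y (1 - catalan_fps)"
    by (simp only: fan_fps_eq)
  then show ?thesis
    by (simp only: mult_2 specialize_mult specialize_diff specialize_add specialize_1)
qed

lemma fps_sqrt_eq:
  assumes "a ^ 2 = b" "a $ 0 = 1"
  shows "fps_sqrt b = a"
proof -
  have b0: "b $ 0 = 1" using assms by (auto simp: power2_eq_square)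
  then have "a ^ Suc 1 = b \<longleftrightarrow> a = fps_radical (\<lambda>_ _. 1) (Suc 1) b"
    using assms by (intro radical_unique) auto
  then show ?thesis
    using assms(1) by (simp add: fps_sqrt_def numeral_2_eq_2)
qed

text \<open>
  From \<open>u (1 + t v\<^sup>2) = v\<close> one gets \<open>(1 - 2 t u v)\<^sup>2 = 1 - 4 t u\<^sup>2\<close>, and also
  \<open>v (-2 + 4 u + t u) = (t u v - 2 u) (1 - 2 v)\<close>; the latter turns \<open>v / (1 - 2 v)\<close>, which is
  \<open>\<Psi> - 1\<close>, into the stated quotient.
\<close>

theorem specialize_fan_fps_closed:
  fixes t u :: "int poly fract fps"
  defines "t \<equiv> fps_const tt" and "u \<equiv> fps_X"
  shows "specialize tt 1 fan_fps = 1 + (1 - 4 * u - fps_sqrt (1 - 4 * t * u ^ 2)) / (2 * (- 2 + 4 * u + t * u))"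
proof -
  define v where "v = specialize tt 1 catalan_fps"
  define D where "D = - 2 + 4 * u + t * u"
  have v: "v = u * (1 + t * (v * v))"
    using specialize_catalan_fps[of tt 1] by (simp add: v_def t_def u_def)
  have fan_fps: "(specialize tt 1 fan_fps - 1) * (1 - 2 * v) = v"
    using specialize_fan_fps[of tt 1] by (simp add: v_def algebra_simps)
  have sq: "fps_sqrt (1 - 4 * t * u ^ 2) = 1 - 2 * t * u * v"
  proof (rule fps_sqrt_eq)
    have "(1 - 2 * t * u * v) ^ 2 = 1 - 4 * t * u * v + 4 * t * u * (u * (1 + t * (v * v)) - u)"
      by (simp add: algebra_simps power2_eq_square)
    then show "(1 - 2 * t * u * v) ^ 2 = 1 - 4 * t * u ^ 2"
      unfolding v[symmetric] by (simp add: algebra_simps power2_eq_square)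
    show "(1 - 2 * t * u * v) $ 0 = 1"
      by (simp add: u_def)
  qed
  have D0: "2 * D \<noteq> 0"
    by (rule fps_nonzeroI[of _ 0]) (simp add: D_def u_def)
  have v0: "1 - 2 * v \<noteq> 0"
    by (rule fps_nonzeroI[of _ 0]) (simp add: v_def)
  have "(specialize tt 1 fan_fps - 1) * D * (1 - 2 * v) = (specialize tt 1 fan_fps - 1) * (1 - 2 * v) * D"
    by (simp only: ac_simps)
  also have "\<dots> = v * D"
    by (simp only: fan_fps)
  also have "\<dots> = 2 * (u * (1 + t * (v * v)) - u - t * u * (v * v)) + 4 * u * v + t * u * v - 2 * v"
    by (simp add: D_def algebra_simps)
  also have "\<dots> = (t * u * v - 2 * u) * (1 - 2 * v)"
    unfolding v[symmetric] by (simp add: algebra_simps)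
  finally have "(specialize tt 1 fan_fps - 1) * D = t * u * v - 2 * u"
    using v0 by simp
  then have "2 * ((specialize tt 1 fan_fps - 1) * D) = 2 * (t * u * v - 2 * u)"
    by (simp only:)
  then have "(specialize tt 1 fan_fps - 1) * (2 * D) = 1 - 4 * u - (1 - 2 * t * u * v)"
    by (simp add: algebra_simps)
  then have "specialize tt 1 fan_fps - 1 = (1 - 4 * u - (1 - 2 * t * u * v)) / (2 * D)"
    using D0 by (metis nonzero_mult_div_cancel_right)
  then show ?thesis
    unfolding sq D_def by (simp add: algebra_simps)
qed

text \<open>
  With \<open>v = v(t, -u)\<close>, uniqueness of the solution of the quadratic equation shows
  \<open>v(1/t, -t u) = t v\<close>. Clearing the denominators \<open>1 - 2 v\<close> and \<open>1 - 2 t v\<close>, the two sides differ by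
  a multiple of \<open>v + u (1 + t v\<^sup>2)\<close>, which is zero.
\<close>

lemma fan_fps_reciprocity:
  fixes t u f G :: "int poly fract fps"
  defines "t \<equiv> fps_const tt" and "u \<equiv> fps_X"
  defines "f \<equiv> specialize tt (-1) fan_fps" and "G \<equiv> specialize (inverse tt) (- tt) fan_fps"
  shows "G * (1 + u + t * u) = f * (1 + u + t * u + u * (1 - t) * G)"
proof -
  define v where "v = specialize tt (-1) catalan_fps"
  have v: "v = - u * (1 + t * (v * v))"
    using specialize_catalan_fps[of tt "-1"] unfolding u_def t_def v_def
    by (simp only: fps_const_neg[symmetric] fps_const_1_eq_1 mult_minus_left mult_1)
  have "fps_const (inverse tt) * t = 1"
    by (simp add: t_def)
  moreover have "fps_const (inverse tt) * ((t * v) * (t * v)) = (fps_const (inverse tt) * t) * (t * (v * v))"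
    by (simp only: ac_simps)
  ultimately have vv: "t * (v * v) = fps_const (inverse tt) * ((t * v) * (t * v))"
    by (simp only: mult_1)
  have "t * v = t * (- u * (1 + t * (v * v)))"
    using v by (rule arg_cong)
  also have "\<dots> = fps_const (- tt) * fps_X * (1 + t * (v * v))"
    by (simp only: t_def u_def fps_const_neg[symmetric] mult_minus_left mult_minus_right mult.assoc)
  also have "\<dots> = fps_const (- tt) * fps_X * (1 + fps_const (inverse tt) * ((t * v) * (t * v)))"
    by (rule arg_cong[OF vv])
  finally have w: "t * v = specialize (inverse tt) (- tt) catalan_fps"
    by (rule quadratic_fps_unique[OF _ specialize_catalan_fps])
  define a b where "a = 1 - 2 * v" and "b = 1 - 2 * (t * v)"
  have f: "f * a = 1 - v"
    using specialize_fan_fps[of tt "-1"] by (simp only: f_def v_def a_def)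
  have G: "G * b = 1 - t * v"
    using specialize_fan_fps[of "inverse tt" "- tt"] by (simp only: G_def w[symmetric] b_def)
  have a0: "a \<noteq> 0"
    by (rule fps_nonzeroI[of _ 0]) (simp add: a_def v_def)
  have b0: "b \<noteq> 0"
    by (rule fps_nonzeroI[of _ 0]) (simp add: b_def v_def)
  let ?P = "1 + u + t * u"
  have "(G * ?P - f * (?P + u * (1 - t) * G)) * (a * b) =
      (G * b) * ?P * a - (f * a) * (?P * b + u * (1 - t) * (G * b))"
    by (simp add: algebra_simps)
  also have "\<dots> = (1 - t * v) * ?P * a - (1 - v) * (?P * b + u * (1 - t) * (1 - t * v))"
    by (simp only: f G)
  also have "\<dots> = (1 - t) * (- u * (1 + t * (v * v)) - v)"
    by (simp add: a_def b_def algebra_simps)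
  also have "\<dots> = 0"
    unfolding v[symmetric] by simp
  finally have "G * ?P - f * (?P + u * (1 - t) * G) = 0"
    using a0 b0 by simp
  then show ?thesis by (simp only: right_minus_eq)
qed

section \<open>The weighted sum over the flats below a word\<close>

text \<open>
  The product of \<open>c\<close> over the lengths of the maximal runs of spokes, where \<open>j\<close> spokes have already
  been read in the current run. Empty runs contribute \<open>c 0\<close>, which is \<open>1\<close> for the fan polynomials.
\<close>

fun run_product :: "(nat \<Rightarrow> 'a::comm_monoid_mult) \<Rightarrow> nat \<Rightarrow> letter list \<Rightarrow> 'a" where
  "run_product c j [] = c j"
| "run_product c j (x # w) = (if x = Spoke then run_product c (Suc j) w else c j * run_product c 0 w)"

text \<open>
  The right-hand side of the recursion at a word for \<open>j = 0\<close>. The parameter \<open>j\<close> is needed to split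
  off a run of spokes letter by letter.
\<close>

definition flat_sum :: "nat \<Rightarrow> letter list \<Rightarrow> int poly fract" where
  "flat_sum j w = (\<Sum>v\<in>subwords w. to_fract (run_product fan_poly j v) * word_weight w v)"

text \<open>
  The part of the sum in which the last vertex is not joined to the hub.
\<close>

definition open_flat_sum :: "letter list \<Rightarrow> int poly fract" where
  "open_flat_sum w =
     (\<Sum>v | v \<in> subwords w \<and> hd v \<noteq> Spoke. to_fract (run_product fan_poly 0 v) * word_weight w v)"

lemma sum_Cons_image: "sum F ((#) x ` A) = (\<Sum>v\<in>A. F (x # v))"
  by (subst sum.reindex) auto

lemma sum_subwords_Cons:
  "(\<Sum>v\<in>subwords (x # w). F v) = (\<Sum>v\<in>subwords w. F (Free # v)) +
     (case x of
        Spoke \<Rightarrow> (\<Sum>v\<in>subwords w. F (Spoke # v)) +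
          (if spoke_top w then \<Sum>v | v \<in> subwords w \<and> hd v \<noteq> Spoke. F (Rim # v) else 0)
      | Rim \<Rightarrow> \<Sum>v\<in>subwords w. F (Rim # v)
      | Free \<Rightarrow> 0)"
proof -
  have fin: "finite ((#) y ` subwords w)" "finite {v \<in> subwords w. hd v \<noteq> Spoke}" for y
    using finite_subwords[of w] by simp_all
  have disj: "(#) y ` A \<inter> (#) z ` B = {}" if "y \<noteq> z" for y z and A B :: "letter list set"
    using that by auto
  show ?thesis
  proof (cases x)
    case Spoke
    have "sum F ((#) Free ` subwords w \<union> ((#) Spoke ` subwords w \<union> (#) Rim ` {v \<in> subwords w. hd v \<noteq> Spoke})) =
       sum F ((#) Free ` subwords w) + (sum F ((#) Spoke ` subwords w) + sum F ((#) Rim ` {v \<in> subwords w. hd v \<noteq> Spoke}))"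
      using fin disj by (subst sum.union_disjoint, auto)+
    moreover have "sum F ((#) Free ` subwords w \<union> (#) Spoke ` subwords w) =
       sum F ((#) Free ` subwords w) + sum F ((#) Spoke ` subwords w)"
      using fin disj by (intro sum.union_disjoint) auto
    ultimately show ?thesis
      using Spoke by (simp add: sum_Cons_image ac_simps)
  next
    case Rim
    have "sum F ((#) Free ` subwords w \<union> (#) Rim ` subwords w) =
       sum F ((#) Free ` subwords w) + sum F ((#) Rim ` subwords w)"
      using fin disj by (intro sum.union_disjoint) auto
    then show ?thesis
      using Rim by (simp add: sum_Cons_image)
  qed (simp add: sum_Cons_image)
qed

lemma flat_sum_Nil: "flat_sum j [] = to_fract (fan_poly j)"
  by (simp add: flat_sum_def)

lemma flat_sum_Free: "flat_sum j (Free # w) = to_fract (fan_poly j) * flat_sum 0 w"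
  unfolding flat_sum_def sum_subwords_Cons by (simp add: local_weight_def sum_distrib_left mult.assoc)

text \<open>
  The last vertex hangs on a single edge, a coloop of the flat. Absent or present, this edge
  contributes \<open>1 - t\<close> or \<open>- 1\<close>.
\<close>

lemma flat_sum_Rim: "flat_sum j (Rim # w) = to_fract (fan_poly j) * (- tt * flat_sum 0 w)"
  unfolding flat_sum_def sum_subwords_Cons
  by (simp add: local_weight_def sum_distrib_left algebra_simps flip: sum.distrib sum_negf)

text \<open>
  If the previous vertex keeps its spoke, the only option for the new vertex has weight \<open>1 - t\<close>.
  If the previous vertex has lost a spoke, the options \<open>Free\<close> and \<open>Rim\<close> together weigh
  \<open>(1 - 2 t) - 1 = (1 - t) - (1 + t)\<close>.
\<close>

lemma open_flat_sum_Spoke: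
  "open_flat_sum (Spoke # w) =
     (1 - tt) * flat_sum 0 w - (if spoke_top w then (1 + tt) * open_flat_sum w else 0)"
proof -
  let ?F = "\<lambda>v. to_fract (run_product fan_poly 0 v) * word_weight w v"
  let ?G = "\<lambda>v. if hd v \<noteq> Spoke then to_fract (run_product fan_poly 0 v) * word_weight (Spoke # w) v else 0"
  have filter: "(\<Sum>v | v \<in> subwords w \<and> hd v \<noteq> Spoke. h v) = (\<Sum>v\<in>subwords w. if hd v \<noteq> Spoke then h v else 0)"
    for h :: "letter list \<Rightarrow> int poly fract"
    using finite_subwords[of w] by (simp add: sum.inter_filter)
  have "open_flat_sum (Spoke # w) = (\<Sum>v\<in>subwords (Spoke # w). ?G v)"
    unfolding open_flat_sum_def using finite_subwords by (intro sum.inter_filter)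
  also have "\<dots> = (\<Sum>v\<in>subwords w. local_weight Spoke w Free v * ?F v) -
      (if spoke_top w then open_flat_sum w else 0)"
    unfolding sum_subwords_Cons by (simp add: open_flat_sum_def local_weight_def sum_negf ac_simps)
  also have "(\<Sum>v\<in>subwords w. local_weight Spoke w Free v * ?F v) =
      (1 - tt) * flat_sum 0 w - (if spoke_top w then tt * open_flat_sum w else 0)"
  proof (cases "spoke_top w")
    case True
    have "(\<Sum>v\<in>subwords w. local_weight Spoke w Free v * ?F v) +
        tt * (\<Sum>v\<in>subwords w. if hd v \<noteq> Spoke then ?F v else 0) = (\<Sum>v\<in>subwords w. (1 - tt) * ?F v)"
      unfolding sum_distrib_left sum.distrib[symmetric]
      by (rule sum.cong[OF refl]) (auto simp: local_weight_def True algebra_simps)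
    then show ?thesis
      unfolding open_flat_sum_def flat_sum_def filter sum_distrib_left[symmetric] eq_diff_eq if_P[OF True] .
  next
    case False
    have "local_weight Spoke w Free v = 1 - tt" for v
      using False by (auto simp: local_weight_def)
    then show ?thesis
      unfolding flat_sum_def if_not_P[OF False] by (simp add: sum_distrib_left)
  qed
  finally show ?thesis
    by (cases "spoke_top w") (auto simp: algebra_simps)
qed

lemma flat_sum_Spoke:
  "flat_sum j (Spoke # w) = to_fract (fan_poly j) * open_flat_sum (Spoke # w) - flat_sum (Suc j) w"
proof -
  have "open_flat_sum (Spoke # w) = (\<Sum>v\<in>subwords (Spoke # w).
      if hd v \<noteq> Spoke then to_fract (run_product fan_poly 0 v) * word_weight (Spoke # w) v else 0)"
    unfolding open_flat_sum_def using finite_subwords by (intro sum.inter_filter)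
  then show ?thesis
    unfolding flat_sum_def sum_subwords_Cons
    by (simp add: local_weight_def sum_distrib_left sum_negf algebra_simps)
qed

lemma flat_sum_no_run:
  assumes "\<not> spoke_top w"
  shows "flat_sum j w = to_fract (fan_poly j) * flat_sum 0 w"
proof (cases w)
  case (Cons x v)
  then show ?thesis using assms
    by (cases x) (simp_all add: flat_sum_Free flat_sum_Rim)
qed (simp add: flat_sum_Nil)

text \<open>
  Here \<open>a\<close> is the length of the run of spokes at the end of the smaller flat.
\<close>

lemma flat_sum_run_expand:
  assumes "\<not> spoke_top w"
  shows "flat_sum j (replicate n Spoke @ w) =
    (\<Sum>a<n. (- 1) ^ a * to_fract (fan_poly (j + a)) * open_flat_sum (replicate (n - a) Spoke @ w)) +
    (- 1) ^ n * to_fract (fan_poly (j + n)) * flat_sum 0 w"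
proof (induction n arbitrary: j)
  case 0
  then show ?case using flat_sum_no_run[OF assms, of j] by simp
next
  case (Suc n)
  show ?case
    by (simp add: flat_sum_Spoke Suc.IH sum.lessThan_Suc_shift sum_negf del: sum.lessThan_Suc)
qed

text \<open>
  The sums over a run and their open parts have the generating functions \<open>T\<close> and \<open>U\<close>, both up to
  the constant factor contributed by the rest of the word. The series \<open>G = \<Psi>(1/t, -t u)\<close> and the
  series \<open>U\<close> computed from it satisfy the same recursion, by the functional equation.
\<close>

lemma flat_sum_run:
  assumes w: "\<not> spoke_top w"
  shows "flat_sum 0 (replicate n Spoke @ w) =
    (- tt) ^ n * eval_at (fan_poly n) (inverse tt) * flat_sum 0 w"
proof -
  define t u :: "int poly fract fps" where "t = fps_const tt" and "u = fps_X"
  define f where "f = specialize tt (- 1) fan_fps"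
  define G where "G = specialize (inverse tt) (- tt) fan_fps"
  define P where "P = 1 + u + t * u"
  define U where "U = u * (1 - t) * G * inverse P"
  have P0: "P $ 0 = 1" by (simp add: P_def u_def)
  then have UP: "U * P = u * (1 - t) * G"
    by (simp add: U_def mult.assoc inverse_mult_eq_1)
  have "G * P = f * (P + u * (1 - t) * G)"
    using fan_fps_reciprocity by (simp add: P_def f_def G_def t_def u_def)
  then have "G * P = f * (1 + U) * P"
    unfolding UP[symmetric] by (simp add: algebra_simps)
  moreover have "P \<noteq> 0" using P0 by force
  ultimately have G: "G = f * (1 + U)" by simp
  have "U = u * ((1 - t) * G - (1 + t) * U)"
    using UP by (simp add: P_def algebra_simps)
  then have U_nth: "U $ n = (u * ((1 - t) * G - (1 + t) * U)) $ n" for n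
    by (rule arg_cong)
  have U0: "U $ 0 = 0" using U_nth[of 0] by (simp add: u_def)
  have U_Suc: "U $ Suc n = (1 - tt) * G $ n - (1 + tt) * U $ n" for n
    using U_nth[of "Suc n"] by (simp add: u_def t_def left_diff_distrib distrib_right)
  have G_nth: "G $ n = (\<Sum>a<n. (- 1) ^ a * to_fract (fan_poly a) * U $ (n - a)) + (- 1) ^ n * to_fract (fan_poly n)"
    for n
    unfolding G by (simp add: fps_mult_nth f_def specialize_def fan_fps_def eval_at_tt atLeast0AtMost
        lessThan_Suc_atMost[symmetric] U0)
  have "flat_sum 0 (replicate n Spoke @ w) = G $ n * flat_sum 0 w \<and>
      (n > 0 \<longrightarrow> open_flat_sum (replicate n Spoke @ w) = U $ n * flat_sum 0 w)" for n
  proof (induction n rule: less_induct)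
    case (less n)
    have top: "open_flat_sum (replicate n Spoke @ w) = U $ n * flat_sum 0 w" if n: "n > 0"
    proof -
      obtain m where m: "n = Suc m" using n gr0_implies_Suc by blast
      show ?thesis
      proof (cases m)
        case 0
        then show ?thesis
          using m w by (auto simp: open_flat_sum_Spoke U_Suc U0 G_nth)
      next
        case (Suc l)
        have "m < n" "m > 0" using m Suc by simp_all
        then have IH: "flat_sum 0 (replicate m Spoke @ w) = G $ m * flat_sum 0 w"
            "open_flat_sum (replicate m Spoke @ w) = U $ m * flat_sum 0 w"
          using less[of m] by blast+
        have "open_flat_sum (replicate n Spoke @ w) = (1 - tt) * flat_sum 0 (replicate m Spoke @ w) -
            (1 + tt) * open_flat_sum (replicate m Spoke @ w)"
          unfolding m replicate_Suc append_Cons open_flat_sum_Spoke using Suc by simp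
        then show ?thesis
          unfolding IH by (simp add: m U_Suc algebra_simps)
      qed
    qed
    have "open_flat_sum (replicate (n - a) Spoke @ w) = U $ (n - a) * flat_sum 0 w" if "a < n" for a
      using less[of "n - a"] top that by (cases "a = 0") auto
    then have "flat_sum 0 (replicate n Spoke @ w) = G $ n * flat_sum 0 w"
      unfolding flat_sum_run_expand[OF w] G_nth by (simp add: sum_distrib_right distrib_right mult.assoc)
    with top show ?case by blast
  qed
  then show ?thesis
    by (simp add: G_def specialize_def fan_fps_def)
qed

lemma run_product_run:
  assumes "\<not> spoke_top w" "c 0 = 1"
  shows "run_product c j (replicate n Spoke @ w) = c (j + n) * run_product c 0 w"
proof (induction n arbitrary: j)
  case 0
  then show ?case using assms by (cases w) auto
qed simp

lemma run_decomposition: obtains n v where "w = replicate n Spoke @ v" "\<not> spoke_top v"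
proof -
  have "\<exists>n v. w = replicate n Spoke @ v \<and> \<not> spoke_top v"
  proof (induction w)
    case Nil
    then show ?case by (intro exI[of _ 0] exI[of _ "[]"]) simp
  next
    case (Cons x w)
    then obtain n v where "w = replicate n Spoke @ v" "\<not> spoke_top v" by blast
    then show ?case
      by (cases "x = Spoke") (metis append_Cons replicate_Suc, metis append_Nil list.sel(1) replicate_0)
  qed
  then show ?thesis using that by blast
qed

text \<open>
  The recursion at an arbitrary flat. Both sides are multiplicative over runs and coloops.
\<close>

theorem flat_sum_eq:
  "flat_sum 0 w = (- tt) ^ word_rank w * eval_at (run_product fan_poly 0 w) (inverse tt)"
proof (induction w rule: length_induct)
  case (1 w)
  obtain n v where w: "w = replicate n Spoke @ v" and v: "\<not> spoke_top v"
    by (rule run_decomposition)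
  have "flat_sum 0 v = (- tt) ^ word_rank v * eval_at (run_product fan_poly 0 v) (inverse tt)"
  proof (cases v)
    case Nil
    then show ?thesis by (simp add: flat_sum_Nil word_rank_def)
  next
    case (Cons x z)
    then have "length z < length w" by (simp add: w)
    then have "flat_sum 0 z = (- tt) ^ word_rank z * eval_at (run_product fan_poly 0 z) (inverse tt)"
      using 1 by blast
    then show ?thesis
      using v Cons by (cases x) (simp_all add: flat_sum_Free flat_sum_Rim word_rank_def)
  qed
  then show ?case
    by (simp add: w flat_sum_run[OF v] run_product_run[OF v] word_rank_def eval_at_mult power_add)
qed

text \<open>
  The extra \<open>1\<close> records strictness, which every run of positive length and every rim letter supplies.
\<close>

lemma degree_run_product:
  "2 * degree (run_product fan_poly j w) + (if j + word_rank w = 0 then 0 else 1) \<le> j + word_rank w"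
proof (induction w arbitrary: j)
  case Nil
  then show ?case using degree_fan_poly[of j] by (auto simp: word_rank_def)
next
  case (Cons x w)
  have rank: "word_rank (x # w) = (if x = Free then 0 else 1) + word_rank w"
    by (simp add: word_rank_def)
  show ?case
  proof (cases "x = Spoke")
    case True
    then show ?thesis using Cons.IH[of "Suc j"] rank by simp
  next
    case False
    have "degree (fan_poly j * run_product fan_poly 0 w) \<le> degree (fan_poly j) + degree (run_product fan_poly 0 w)"
      by (rule degree_mult_le)
    then show ?thesis
      using False rank Cons.IH[of 0] degree_fan_poly[of j] by (auto split: if_splits)
  qed
qed

lemma run_product_rank_0: "word_rank w = 0 \<Longrightarrow> run_product fan_poly 0 w = 1"
  by (induction w) (auto simp: word_rank_def split: if_splits)

text \<open>
  Words of one fixed length are used, because there a graph determines its word: dropping isolated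
  vertices makes words that differ in trailing free vertices give the same graph.
\<close>

theorem inverse_KL_word_graph:
  assumes "admissible w"
  shows "inverse_KL (word_graph w) = run_product fan_poly 0 w"
proof -
  define \<W> where "\<W> = {v. admissible v \<and> length v = length w}"
  \<comment> \<open>Outside the flats under consideration, the values of \<open>Q\<close> are arbitrary.\<close>
  define Q where "Q H = run_product fan_poly 0 (the_inv_into \<W> word_graph H)" for H
  have edges: "edges (word_graph v) = word_edges v" for v
    by (simp add: word_graph_def)
  have inj: "inj_on word_graph \<W>"
    using word_edges_inject edges by (intro inj_onI) (metis (mono_tags, lifting) \<W>_def mem_Collect_eq)
  have Q: "Q (word_graph v) = run_product fan_poly 0 v" if "v \<in> \<W>" for v
    using that by (simp add: Q_def the_inv_into_f_f[OF inj])
  have sub: "v' \<in> \<W>" if "v \<in> \<W>" "v' \<in> subwords v" for v v'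
    using that admissible_subword length_subword by (auto simp: \<W>_def)
  have "inverse_KL (word_graph w) = Q (word_graph w)"
  proof (rule inverse_KL_eqI[where \<G> = "word_graph ` \<W>"])
    show "word_graph w \<in> word_graph ` \<W>"
      using assms by (simp add: \<W>_def)
    show "graph G" if "G \<in> word_graph ` \<W>" for G
      using that graph_word_graph by auto
    show "edge_sub G F \<in> word_graph ` \<W>" if G: "G \<in> word_graph ` \<W>" "F \<in> flats G" for G F
    proof -
      obtain v where v: "v \<in> \<W>" "G = word_graph v" using G(1) by blast
      then have "F \<in> word_edges ` subwords v"
        using G(2) flats_word_graph[of v] by (simp add: \<W>_def)
      then show ?thesis
        using v sub by (auto simp: edge_sub_word_graph)
    qed
    show "invKL_at Q G" if G: "G \<in> word_graph ` \<W>" for G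
    proof -
      obtain v where v: "v \<in> \<W>" "G = word_graph v" using G by blast
      then have adm: "admissible v" by (simp add: \<W>_def)
      have "inj_on word_edges (subwords v)"
        using word_edges_inject admissible_subword[OF adm] length_subword by (metis inj_onI)
      then have "(\<Sum>F\<in>flats G. (- 1) ^ rk (edge_sub G F) * to_fract (Q (edge_sub G F)) * contraction_weight G F) =
        (\<Sum>z\<in>subwords v. (- 1) ^ rk (word_graph z) * to_fract (Q (word_graph z)) *
           contraction_weight (word_graph v) (word_edges z))"
        unfolding v(2) flats_word_graph[OF adm] by (simp add: sum.reindex edge_sub_word_graph)
      also have "\<dots> = flat_sum 0 v"
        unfolding flat_sum_def
      proof (rule sum.cong[OF refl])
        fix z assume z: "z \<in> subwords v"
        show "(- 1) ^ rk (word_graph z) * to_fract (Q (word_graph z)) *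
           contraction_weight (word_graph v) (word_edges z) =
           to_fract (run_product fan_poly 0 z) * word_weight v z"
          unfolding contraction_weight_word[OF adm z, symmetric] rk_word_graph[OF admissible_subword[OF adm z]]
            Q[OF sub[OF v(1) z]] by simp
      qed
      also have "\<dots> = (- tt) ^ rk G * eval_at (Q G) (inverse tt)"
        by (simp add: flat_sum_eq v rk_word_graph[OF adm] Q[OF v(1)])
      finally have sum: "(- tt) ^ rk G * eval_at (Q G) (inverse tt) =
        (\<Sum>F\<in>flats G. (- 1) ^ rk (edge_sub G F) * to_fract (Q (edge_sub G F)) * contraction_weight G F)" ..
      have "graph G" using v graph_word_graph by simp
      then show ?thesis
        unfolding invKL_at_iff_flats[OF \<open>graph G\<close>] sum
        using degree_run_product[of 0 v] run_product_rank_0[of v]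
        by (auto simp: v rk_word_graph[OF adm] Q[OF v(1)])
    qed
  qed
  also have "\<dots> = run_product fan_poly 0 w"
    using assms by (intro Q) (simp add: \<W>_def)
  finally show ?thesis .
qed

lemma inverse_KL_rank_0:
  assumes "graph G" "rk G = 0"
  shows "inverse_KL G = 1"
  using assms by (subst inverse_KL.simps) (simp add: invKL_at_def)

lemma word_edges_replicate:
  "word_edges (replicate n Spoke) = {{i, i + 1} | i. 1 \<le> i \<and> i < n} \<union> {{0, i} | i. 1 \<le> i \<and> i \<le> n}"
proof (induction n)
  case (Suc n)
  have "{{i, i + 1} | i. 1 \<le> i \<and> i < Suc n} = {{i, i + 1} | i. 1 \<le> i \<and> i < n} \<union> (if n = 0 then {} else {{n, Suc n}})"
    by (auto simp: less_Suc_eq)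
  moreover have "{{0, i} | i. 1 \<le> i \<and> i \<le> Suc n} = insert {0, Suc n} {{0, i} | i. 1 \<le> i \<and> i \<le> n}"
    by (auto simp: le_Suc_eq)
  moreover have "last_edges Spoke (replicate n Spoke) = insert {0, Suc n} (if n = 0 then {} else {{n, Suc n}})"
    by (cases n) (simp_all add: last_edges_def)
  ultimately show ?case using Suc by auto
qed auto

text \<open>
  The case \<open>n = 0\<close> differs, because the graph of the empty word has no vertices at all.
\<close>

lemma fan_eq_word_graph:
  assumes "n > 0"
  shows "fan n = word_graph (replicate n Spoke)"
proof -
  have "(\<Union>e\<in>word_edges (replicate n Spoke). e) = {0..n}"
  proof
    show "(\<Union>e\<in>word_edges (replicate n Spoke). e) \<subseteq> {0..n}"
      using word_edges_bound[of _ "replicate n Spoke"] by fastforce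
    show "{0..n} \<subseteq> (\<Union>e\<in>word_edges (replicate n Spoke). e)"
    proof
      fix i assume i: "i \<in> {0..n}"
      have "{0, max i 1} \<in> word_edges (replicate n Spoke)"
        unfolding word_edges_replicate using i assms by auto
      moreover have "i \<in> {0, max i 1}" by auto
      ultimately show "i \<in> (\<Union>e\<in>word_edges (replicate n Spoke). e)" by blast
    qed
  qed
  then show ?thesis
    unfolding fan_def word_graph_def word_edges_replicate by simp
qed

lemma inverse_KL_fan: "inverse_KL (fan n) = fan_poly n"
proof (cases "n = 0")
  case True
  have graph: "graph (fan 0)" by (simp add: graph_def fan_def)
  have "components (fan 0) \<noteq> {}" by (simp add: components_def fan_def)
  then have "card (components (fan 0)) > 0"
    using finite_components[of "fan 0"] graph by (simp add: card_gt_0_iff graph_def)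
  then have "rk (fan 0) = 0" by (simp add: rk_def fan_def)
  then show ?thesis using inverse_KL_rank_0[OF graph] True by simp
next
  case False
  have "admissible (replicate n Spoke)" by (induction n) auto
  then have "inverse_KL (fan n) = run_product fan_poly 0 (replicate n Spoke @ [])"
    using False by (simp add: fan_eq_word_graph inverse_KL_word_graph)
  also have "\<dots> = fan_poly n"
    by (subst run_product_run) simp_all
  finally show ?thesis .
qed

theorem theorem2p1:
  fixes t u :: "int poly fract fps"
  defines "t \<equiv> fps_const tt" and "u \<equiv> fps_X"
  shows "Psi = 1 + (1 - 4 * u - fps_sqrt (1 - 4 * t * u ^ 2)) / (2 * (- 2 + 4 * u + t * u))"
proof -
  have "Psi = specialize tt 1 fan_fps"
    by (simp add: Psi_def specialize_def fan_fps_def inverse_KL_fan eval_at_tt)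
  then show ?thesis
    unfolding t_def u_def by (simp only: specialize_fan_fps_closed)
qed

end
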